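(* Let $f_m(z)=\sum_{k=-m}^m a_k z^{-k}$ be a Laurent polynomial with $m\ge 1$, real coefficients $a_k$ and $a_{\pm m}\neq 0$. Suppose that the set $\mathbf{Z}(f_m)$ is spanned by a $C^1$ polar curve $p(\mathbb{T})$, i.e. $\mathbf{Z}(f_m)=\bigcup_{\alpha\in[-\pi,\pi]}\{p(e^{\mathrm{i}\alpha})\}$ where $p(e^{\mathrm{i}\alpha})=e^{\mathrm{i}(\alpha+\mathrm{i}\beta(\alpha))}$, and suppose that the separation assumption holds: for every $\lambda\in\mathbb{R}$ with $|z_m(\lambda)|=|z_{m+1}(\lambda)|$ one has $$|z_{m-1}(\lambda)|<|z_m(\lambda)|=|z_{m+1}(\lambda)|<|z_{m+2}(\lambda)|.$$ Then $$\lim_{n\to\infty}\sigma\bigl(\mathbf{T}_n(f_m)\bigr)=\bigcup_{\alpha\in[-\pi,\pi]}\bigl\{f_m\bigl(e^{\mathrm{i}(\alpha+\mathrm{i}\beta(\alpha))}\bigr)\bigr\}\subset\mathbb{R},$$ where the limit is in the Hausdorff sense.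
   Context: $\mathbf{T}_n(f_m)$ is the $n\times n$ Toeplitz matrix with $(i,j)$ entry $a_{i-j}$ (with $a_k=0$ for $|k|>m$), and $\sigma$ denotes the set of eigenvalues. For $\lambda\in\mathbb{C}$, $z_1(\lambda),\dots,z_{2m}(\lambda)$ denote the roots (with multiplicity) of the polynomial $z^m(f_m(z)-\lambda)$ in $z$, sorted so that $0<|z_1(\lambda)|\le|z_2(\lambda)|\le\dots\le|z_{2m}(\lambda)|$. Inequalities involving the non-existent roots $z_0$ or $z_{2m+1}$ (when $m=1$) are regarded as vacuous. $\mathbf{Z}(f_m):=\{z_m(\lambda),z_{m+1}(\lambda)\in\mathbb{C} : |z_m(\lambda)|=|z_{m+1}(\lambda)|\text{ for some }\lambda\in\mathbb{R}\}$, i.e. the set of all middle roots $z_m(\lambda),z_{m+1}(\lambda)$ over those real $\lambda$ for which these two roots have equal modulus. A $C^1$ polar curve is a set parametrised as $p(e^{\mathrm{i}\theta})=r(\theta)e^{\mathrm{i}\theta}$, $\theta\in[-\pi,\pi]$, for a continuously differentiable $r:[-\pi,\pi]\to(0,\infty)$ with $r(-\theta)=r(\theta)$ and $r'(\pi)=r'(-\pi)$. It is denoted $p(\mathbb{T})$, $\mathbb{T}$ being the unit circle. Writing $r(\alpha)=e^{-\beta(\alpha)}$ with $\beta$ real-valued, one has $p(e^{\mathrm{i}\alpha})=e^{\mathrm{i}(\alpha+\mathrm{i}\beta(\alpha))}$. "$\mathbf{Z}(f_m)$ is spanned by the polar curve $p(\mathbb{T})$" means $\mathbf{Z}(f_m)=p(\mathbb{T})$.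 *)

theory Defs
  imports
    "HOL-Analysis.Analysis"
    "HOL-Computational_Algebra.Computational_Algebra"
    "Jordan_Normal_Form.Spectral_Radius"
begin

definition laurent :: "(int \<Rightarrow> real) \<Rightarrow> nat \<Rightarrow> complex \<Rightarrow> complex" where
  "laurent a m z = (\<Sum>k\<in>{- int m..int m}. complex_of_real (a k) * z powi (- k))"

text \<open>
  The entries outside the band are cut off explicitly, so the values of the
  coefficient function beyond the range \<open>-m..m\<close> play no role.
\<close>

definition toeplitz :: "(int \<Rightarrow> real) \<Rightarrow> nat \<Rightarrow> nat \<Rightarrow> complex mat" where
  "toeplitz a m n = mat n n (\<lambda>(i, j).
     if \<bar>int i - int j\<bar> \<le> int m then complex_of_real (a (int i - int j)) else 0)"

definition char_laurent_poly :: "(int \<Rightarrow> real) \<Rightarrow> nat \<Rightarrow> complex \<Rightarrow> complex poly" where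
  "char_laurent_poly a m lam =
     (\<Sum>k\<in>{- int m..int m}. monom (complex_of_real (a k)) (nat (int m - k))) - monom lam m"

lemma poly_char_laurent_poly:
  assumes "z \<noteq> 0"
  shows "poly (char_laurent_poly a m lam) z = z ^ m * (laurent a m z - lam)"
proof -
  have "z ^ nat (int m - k) = z ^ m * z powi (- k)" if "k \<in> {- int m..int m}" for k
  proof -
    have "z ^ nat (int m - k) = z powi (int m - k)"
      using that by (simp add: power_int_def)
    also have "\<dots> = z powi (int m) * z powi (- k)"
      using assms power_int_add[of z "int m" "- k"] by simp
    finally show ?thesis by simp
  qed
  then show ?thesis
    unfolding char_laurent_poly_def laurent_def
    by (auto simp: poly_sum poly_monom algebra_simps sum_distrib_left intro!: sum.cong)
qed

text \<open>
  \<open>z j lam\<close>, for \<open>j = 1, \<dots>, 2 * m\<close>, enumerates the roots with multiplicity in an order of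
  non-decreasing modulus. Roots of equal modulus may come in any order; indices outside
  \<open>1..2 * m\<close> are unconstrained.
\<close>

definition sorted_roots ::
  "(int \<Rightarrow> real) \<Rightarrow> nat \<Rightarrow> (nat \<Rightarrow> complex \<Rightarrow> complex) \<Rightarrow> bool" where
  "sorted_roots a m z \<longleftrightarrow> (\<forall>lam.
     image_mset (\<lambda>j. z j lam) (mset_set {1..2 * m}) = proots (char_laurent_poly a m lam) \<and>
     (\<forall>i j. 1 \<le> i \<longrightarrow> i \<le> j \<longrightarrow> j \<le> 2 * m \<longrightarrow> cmod (z i lam) \<le> cmod (z j lam)))"

definition middle_roots :: "nat \<Rightarrow> (nat \<Rightarrow> complex \<Rightarrow> complex) \<Rightarrow> complex set" where
  "middle_roots m z =
     (\<Union>lam\<in>{lam \<in> \<real>. cmod (z m lam) = cmod (z (m + 1) lam)}. {z m lam, z (m + 1) lam})"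

text \<open>For \<open>m = 1\<close> the two strict inequalities refer to non-existent roots.\<close>

definition separated :: "nat \<Rightarrow> (nat \<Rightarrow> complex \<Rightarrow> complex) \<Rightarrow> bool" where
  "separated m z \<longleftrightarrow> (\<forall>lam\<in>\<real>. cmod (z m lam) = cmod (z (m + 1) lam) \<longrightarrow> 2 \<le> m \<longrightarrow>
     cmod (z (m - 1) lam) < cmod (z m lam) \<and> cmod (z (m + 1) lam) < cmod (z (m + 2) lam))"

text \<open>Derivatives at the end points of \<open>[-pi, pi]\<close> are one-sided.\<close>

definition C1_polar_radius :: "(real \<Rightarrow> real) \<Rightarrow> bool" where
  "C1_polar_radius r \<longleftrightarrow>
     (\<forall>\<theta>\<in>{-pi..pi}. 0 < r \<theta> \<and> r (- \<theta>) = r \<theta>) \<and>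
     (\<exists>r'. (\<forall>\<theta>\<in>{-pi..pi}. (r has_real_derivative r' \<theta>) (at \<theta> within {-pi..pi})) \<and>
           continuous_on {-pi..pi} r' \<and> r' pi = r' (- pi))"

definition polar_curve :: "(real \<Rightarrow> real) \<Rightarrow> complex set" where
  "polar_curve r = (\<lambda>\<theta>. complex_of_real (r \<theta>) * cis \<theta>) ` {-pi..pi}"

text \<open>The Hausdorff distance; only meaningful for nonempty bounded sets.\<close>

definition hausdorff_dist :: "'a::metric_space set \<Rightarrow> 'a set \<Rightarrow> real" where
  "hausdorff_dist A B = max (SUP x\<in>A. infdist x B) (SUP y\<in>B. infdist y A)"

definition hausdorff_limit :: "(nat \<Rightarrow> 'a::metric_space set) \<Rightarrow> 'a set \<Rightarrow> bool" where
  "hausdorff_limit S L \<longleftrightarrow> (\<lambda>n. hausdorff_dist (S n) L) \<longlonglongrightarrow> 0"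

end

theory Submission
  imports Defs "HOL-Complex_Analysis.Great_Picard"
begin

text \<open>
  Write \<open>P lam\<close> for the polynomial with roots \<open>z 1 lam, \<dots>, z (2 * m) lam\<close> and \<open>L\<close> for the set of values of
  the symbol on the polar curve. Every point of the curve is a middle root for some real \<open>lam\<close>, so
  \<open>L\<close> is a compact subset of the reals; it is also connected, hence a segment. Hausdorff convergence
  of the spectra to \<open>L\<close> means that eigenvalues stay close to \<open>L\<close> and that they leave no gap in \<open>L\<close>.

  Eigenvalues stay close to \<open>L\<close>. An eigenvector turns into a nonzero multiple \<open>R\<close> of \<open>P lam\<close> whose
  coefficients vanish except for \<open>m\<close> at the bottom and \<open>m\<close> at the top, with \<open>n\<close> zeros between them. If
  \<open>m\<close> roots have modulus at most \<open>\<rho>1\<close>, divisibility by the corresponding factor bounds the low block by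
  \<open>C * s ^ (m + n)\<close> times the high block for any \<open>s > \<rho>1\<close>; the reversed polynomial gives the opposite bound when the other
  \<open>m\<close> roots have modulus at least \<open>\<rho>2 > \<rho>1\<close>. For large \<open>n\<close> both cannot hold (\<open>spectrum_excluded_by_modulus_gap\<close>). Since moduli
  of sorted roots are continuous in \<open>lam\<close>, this excludes eigenvalues near every \<open>lam\<close> with
  \<open>cmod (z m lam) < cmod (z (m + 1) lam)\<close>.

  That strict inequality holds off \<open>L\<close> (\<open>middle_roots_separated\<close>). For \<open>lam\<close> off \<open>L\<close> no root lies on the
  curve, so the number of roots inside the curve is constant on the connected complement of \<open>L\<close>;
  letting \<open>lam\<close> tend to infinity shows that it is \<open>m\<close>. If the inequality failed there would be two
  points \<open>w\<close> inside and \<open>v\<close> outside the curve with the same value of the symbol and \<open>cmod v \<le> cmod w\<close>.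
  Take such a pair, on or off the curve, with \<open>cmod w / cmod v\<close> maximal. Over \<open>L\<close> the separation
  assumption forces this quotient to be at most 1, so a maximal pair over the complement of \<open>L\<close>
  exists as well. But there one may enlarge \<open>u = w / v\<close> slightly and, by Hurwitz, still solve
  \<open>f (u * v) = f v\<close> near \<open>v\<close>, unless \<open>f (u * x) = f x\<close> identically; and such a symmetry would give three
  roots the modulus of the middle roots, which separation reserves for two. This contradicts maximality.

  No gap in \<open>L\<close> (\<open>eigenvalues_near_curve_value\<close>). The normalised traces of the powers of the Toeplitz
  matrices converge to the constant coefficients of the powers of the symbol. These are the
  contour integrals of the powers against \<open>dz / z\<close>, and moving the contour to the polar curve makes them the
  moments of a positive measure on \<open>L\<close> with support \<open>L\<close>. Testing with high powers of a parabola
  that peaks at a point of \<open>L\<close> shows that eigenvalues must come close to that point.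
\<close>

section \<open>Roots of the characteristic Laurent polynomial\<close>

locale laurent_symbol =
  fixes a :: "int \<Rightarrow> real" and m :: nat
  assumes m_pos: "1 \<le> m" and a_top: "a (int m) \<noteq> 0" and a_bot: "a (- int m) \<noteq> 0"
begin

abbreviation P :: "complex \<Rightarrow> complex poly" where "P \<equiv> char_laurent_poly a m"
abbreviation f :: "complex \<Rightarrow> complex" where "f \<equiv> laurent a m"

lemma coeff_P:
  "coeff (P lam) i =
     (if i \<le> 2 * m then complex_of_real (a (int m - int i)) else 0) - (if i = m then lam else 0)"
proof -
  have "coeff (\<Sum>k\<in>{- int m..int m}. monom (complex_of_real (a k)) (nat (int m - k))) i
        = (\<Sum>k\<in>{- int m..int m}. if k = int m - int i then complex_of_real (a k) else 0)"
    unfolding coeff_sum by (intro sum.cong) auto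
  also have "\<dots> = (if i \<le> 2 * m then complex_of_real (a (int m - int i)) else 0)"
    by (subst sum.delta) auto
  finally show ?thesis
    by (auto simp: char_laurent_poly_def)
qed

lemma degree_P: "degree (P lam) = 2 * m"
proof (rule antisym)
  show "degree (P lam) \<le> 2 * m"
    by (rule degree_le) (auto simp: coeff_P)
  show "2 * m \<le> degree (P lam)"
    using m_pos a_bot by (intro le_degree) (auto simp: coeff_P)
qed

lemma lead_coeff_P: "lead_coeff (P lam) = complex_of_real (a (- int m))"
  using m_pos by (simp add: degree_P coeff_P)

lemma P_nonzero [simp]: "P lam \<noteq> 0"
  using degree_P[of lam] m_pos by auto

text \<open>
  The constant coefficient of \<open>P lam\<close> is \<open>a m\<close>, which is nonzero, so
  clearing denominators adds no root at zero.
\<close>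

lemma poly_P_eq_0_iff: "poly (P lam) w = 0 \<longleftrightarrow> w \<noteq> 0 \<and> f w = lam"
proof (cases "w = 0")
  case True
  have "poly (P lam) 0 = complex_of_real (a (int m))"
    using m_pos by (simp add: poly_0_coeff_0 coeff_P)
  then show ?thesis using True a_top by simp
qed (simp add: poly_char_laurent_poly)

lemma f_cnj: "f (cnj w) = cnj (f w)"
  by (simp add: laurent_def complex_cnj_power_int)

lemma continuous_on_f [continuous_intros]:
  assumes "continuous_on S g" "\<And>x. x \<in> S \<Longrightarrow> g x \<noteq> 0"
  shows "continuous_on S (\<lambda>x. f (g x))"
  unfolding laurent_def by (intro continuous_intros assms) (use assms in auto)

lemma holomorphic_f [holomorphic_intros]:
  assumes "g holomorphic_on S" "\<And>x. x \<in> S \<Longrightarrow> g x \<noteq> 0"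
  shows "(\<lambda>x. f (g x)) holomorphic_on S"
  unfolding laurent_def by (intro holomorphic_intros assms) (use assms in auto)

lemma tendsto_poly_P:
  assumes "(X \<longlongrightarrow> lam) F"
  shows "((\<lambda>n. poly (P (X n)) w) \<longlongrightarrow> poly (P lam) w) F"
proof -
  have *: "poly (P l) w = poly (P 0) w - l * w ^ m" for l
    by (simp add: char_laurent_poly_def poly_monom)
  show ?thesis
    unfolding *[of lam] *[of "X _"] by (intro tendsto_intros assms)
qed

text \<open>
  The leading coefficient does not depend on \<open>lam\<close>, so a root of modulus above 1 is
  bounded by the sum of the other coefficients divided by it.
\<close>

lemma root_bound:
  obtains C where "\<And>lam w. cmod lam \<le> B \<Longrightarrow> poly (P lam) w = 0 \<Longrightarrow> cmod w \<le> C"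
proof
  fix lam w
  define D where "D = (\<Sum>i<2*m. \<bar>a (int m - int i)\<bar> + \<bar>B\<bar>)"
  assume lam: "cmod lam \<le> B" and root: "poly (P lam) w = 0"
  show "cmod w \<le> max 1 ((\<Sum>i<2*m. \<bar>a (int m - int i)\<bar> + \<bar>B\<bar>) / \<bar>a (- int m)\<bar>)"
  proof (cases "cmod w \<le> 1")
    case False
    obtain k where k: "2 * m = Suc k"
      using m_pos by (cases "2 * m") auto
    have "0 = (\<Sum>i\<le>2 * m. coeff (P lam) i * w ^ i)"
      using root by (simp add: poly_altdef degree_P)
    also have "\<dots> = (\<Sum>i<2*m. coeff (P lam) i * w ^ i) + complex_of_real (a (- int m)) * w ^ (2 * m)"
      using m_pos by (simp add: lessThan_Suc_atMost[symmetric] coeff_P)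
    finally have "cmod (complex_of_real (a (- int m)) * w ^ (2 * m))
        = cmod (\<Sum>i<2*m. coeff (P lam) i * w ^ i)"
      by (metis add.inverse_unique norm_minus_cancel)
    also have "\<dots> \<le> (\<Sum>i<2*m. (\<bar>a (int m - int i)\<bar> + \<bar>B\<bar>) * cmod w ^ k)"
    proof (rule sum_norm_le)
      fix i assume i: "i \<in> {..<2*m}"
      have "cmod (coeff (P lam) i) \<le> \<bar>a (int m - int i)\<bar> + \<bar>B\<bar>"
        using lam i by (auto simp: coeff_P intro: order_trans[OF norm_triangle_ineq4])
      moreover have "cmod w ^ i \<le> cmod w ^ k"
        using False i k by (intro power_increasing) auto
      ultimately show "cmod (coeff (P lam) i * w ^ i) \<le> (\<bar>a (int m - int i)\<bar> + \<bar>B\<bar>) * cmod w ^ k"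
        unfolding norm_mult norm_power by (intro mult_mono) auto
    qed
    also have "\<dots> = D * cmod w ^ k"
      unfolding D_def by (rule sum_distrib_right[symmetric])
    finally have "\<bar>a (- int m)\<bar> * cmod w ^ (2 * m) \<le> D * cmod w ^ k"
      by (simp add: norm_mult norm_power)
    then have "\<bar>a (- int m)\<bar> * cmod w * cmod w ^ k \<le> D * cmod w ^ k"
      unfolding k by (simp add: mult_ac)
    moreover have "0 < cmod w ^ k"
      using False by (intro zero_less_power) linarith
    ultimately have "\<bar>a (- int m)\<bar> * cmod w \<le> D"
      by (simp add: mult_le_cancel_right)
    then have "cmod w \<le> D / \<bar>a (- int m)\<bar>"
      using a_bot by (simp add: field_simps)
    then show ?thesis
      by (simp add: D_def)
  qed simp
qed

end

text \<open>
  Repeated extraction of subsequences, one index after the other.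
\<close>

lemma simultaneous_subsequence:
  fixes x :: "'b \<Rightarrow> nat \<Rightarrow> 'a::heine_borel"
  assumes "finite J" "\<And>j. j \<in> J \<Longrightarrow> bounded (range (x j))"
  shows "\<exists>\<phi>. strict_mono (\<phi> :: nat \<Rightarrow> nat) \<and> (\<forall>j\<in>J. convergent (\<lambda>n. x j (\<phi> n)))"
  using assms
proof (induction J rule: finite_induct)
  case empty
  show ?case by (rule exI[of _ id]) (auto simp: strict_mono_def)
next
  case (insert i J)
  then obtain \<phi> where \<phi>: "strict_mono (\<phi> :: nat \<Rightarrow> nat)" "\<And>j. j \<in> J \<Longrightarrow> convergent (\<lambda>n. x j (\<phi> n))"
    by auto
  have "bounded (range (\<lambda>n. x i (\<phi> n)))"
    using insert.prems[of i] by (auto intro: bounded_subset)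
  then obtain l \<psi> where \<psi>: "strict_mono (\<psi> :: nat \<Rightarrow> nat)" "((\<lambda>n. x i (\<phi> n)) \<circ> \<psi>) \<longlonglongrightarrow> l"
    using bounded_imp_convergent_subsequence by blast
  show ?case
  proof (intro exI[of _ "\<phi> \<circ> \<psi>"] conjI ballI)
    show "strict_mono (\<phi> \<circ> \<psi>)" using \<phi>(1) \<psi>(1) by (rule strict_mono_o)
    fix j assume "j \<in> insert i J"
    then show "convergent (\<lambda>n. x j ((\<phi> \<circ> \<psi>) n))"
    proof
      assume "j = i"
      then show ?thesis using \<psi>(2) by (auto simp: convergent_def o_def)
    next
      assume "j \<in> J"
      from convergent_subseq_convergent[OF \<phi>(2)[OF this] \<psi>(1)] show ?thesis
        by (simp add: o_def)
    qed
  qed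
qed

lemma sorted_enumeration_unique:
  fixes u v :: "nat \<Rightarrow> 'a::linorder"
  assumes "image_mset u (mset_set {1..k}) = image_mset v (mset_set {1..k})"
    and "\<And>i j. 1 \<le> i \<Longrightarrow> i \<le> j \<Longrightarrow> j \<le> k \<Longrightarrow> u i \<le> u j"
    and "\<And>i j. 1 \<le> i \<Longrightarrow> i \<le> j \<Longrightarrow> j \<le> k \<Longrightarrow> v i \<le> v j"
    and "j \<in> {1..k}"
  shows "u j = v j"
proof -
  have eq: "mset (map u [1..<Suc k]) = mset (map v [1..<Suc k])"
    using assms(1) by (simp add: mset_upt atLeastLessThanSuc_atLeastAtMost del: upt_Suc)
  have su: "sorted (map u [1..<Suc k])" and sv: "sorted (map v [1..<Suc k])"
    unfolding sorted_iff_nth_mono using assms(2,3) by (auto simp del: upt_Suc)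
  have "map u [1..<Suc k] = map v [1..<Suc k]"
    using properties_for_sort[OF eq su] properties_for_sort[OF refl sv] by metis
  then show ?thesis using assms(4) by (auto simp del: upt_Suc)
qed

locale sorted_symbol = laurent_symbol +
  fixes z :: "nat \<Rightarrow> complex \<Rightarrow> complex"
  assumes sorted: "sorted_roots a m z"
begin

lemma roots_mset: "image_mset (\<lambda>j. z j lam) (mset_set {1..2 * m}) = proots (P lam)"
  using sorted unfolding sorted_roots_def by blast

lemma modulus_mono: "1 \<le> i \<Longrightarrow> i \<le> j \<Longrightarrow> j \<le> 2 * m \<Longrightarrow> cmod (z i lam) \<le> cmod (z j lam)"
  using sorted unfolding sorted_roots_def by blast

lemma enumeration_set:
  assumes "image_mset \<zeta> (mset_set {1..2 * m}) = proots (P lam)"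
  shows "\<zeta> ` {1..2 * m} = {w. poly (P lam) w = 0}"
proof -
  have "set_mset (image_mset \<zeta> (mset_set {1..2 * m})) = {w. poly (P lam) w = 0}"
    unfolding assms by simp
  then show ?thesis by simp
qed

lemmas roots_set = enumeration_set[OF roots_mset]

lemma root_z: "j \<in> {1..2*m} \<Longrightarrow> poly (P lam) (z j lam) = 0"
  using roots_set by blast

lemma P_factor: "P lam = Polynomial.smult (of_real (a (- int m))) (\<Prod>j\<in>{1..2*m}. [:- z j lam, 1:])"
proof -
  have "P lam = Polynomial.smult (lead_coeff (P lam)) (\<Prod>x\<in>#proots (P lam). [:- x, 1:])"
    by (rule complex_poly_decompose_multiset[symmetric])
  also have "(\<Prod>x\<in>#proots (P lam). [:- x, 1:]) = (\<Prod>j\<in>{1..2*m}. [:- z j lam, 1:])"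
    unfolding roots_mset[symmetric] by (simp add: prod_unfold_prod_mset image_mset.compositionality o_def)
  finally show ?thesis unfolding lead_coeff_P .
qed

text \<open>
  Continuous dependence of the roots on \<open>lam\<close>, in a form that needs no choice of
  branches: along a subsequence all sorted roots converge, and the limits enumerate the roots of
  the limit polynomial, because the factorisation \<open>P_factor\<close> passes to the limit.
  Limits of sorted moduli are sorted, so they are the moduli of \<open>z j lam\<close>; the
  limits themselves may differ from \<open>z j lam\<close> by a permutation among equal moduli.
\<close>

lemma roots_subsequence:
  assumes X: "X \<longlonglongrightarrow> lam"
  obtains \<phi> \<zeta> where "strict_mono (\<phi> :: nat \<Rightarrow> nat)"
    "\<And>j. j \<in> {1..2*m} \<Longrightarrow> (\<lambda>n. z j (X (\<phi> n))) \<longlonglongrightarrow> \<zeta> j"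
    "image_mset \<zeta> (mset_set {1..2 * m}) = proots (P lam)"
    "\<And>j. j \<in> {1..2*m} \<Longrightarrow> cmod (\<zeta> j) = cmod (z j lam)"
proof -
  obtain B where B: "\<And>n. cmod (X n) \<le> B"
    using convergent_imp_bounded[OF X] unfolding bounded_iff by auto
  obtain C where C: "\<And>lam w. cmod lam \<le> B \<Longrightarrow> poly (P lam) w = 0 \<Longrightarrow> cmod w \<le> C"
    using root_bound by blast
  have "bounded (range (\<lambda>n. z j (X n)))" if "j \<in> {1..2*m}" for j
    using C[OF B root_z[OF that]] by (auto simp: bounded_iff)
  then obtain \<phi> where \<phi>: "strict_mono (\<phi> :: nat \<Rightarrow> nat)"
      and conv: "\<And>j. j \<in> {1..2*m} \<Longrightarrow> convergent (\<lambda>n. z j (X (\<phi> n)))"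
    using simultaneous_subsequence[of "{1..2*m}" "\<lambda>j n. z j (X n)"] by auto
  define \<zeta> where "\<zeta> = (\<lambda>j. lim (\<lambda>n. z j (X (\<phi> n))))"
  have lim: "(\<lambda>n. z j (X (\<phi> n))) \<longlonglongrightarrow> \<zeta> j" if "j \<in> {1..2*m}" for j
    using conv[OF that] by (simp add: \<zeta>_def convergent_LIMSEQ_iff)
  define c where "c = complex_of_real (a (- int m))"
  have "poly (P lam) w = poly (Polynomial.smult c (\<Prod>j\<in>{1..2*m}. [:- \<zeta> j, 1:])) w" for w
  proof (rule LIMSEQ_unique)
    show "(\<lambda>n. poly (P (X (\<phi> n))) w) \<longlonglongrightarrow> poly (P lam) w"
      using LIMSEQ_subseq_LIMSEQ[OF X \<phi>] by (intro tendsto_poly_P) (simp add: o_def)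
    show "(\<lambda>n. poly (P (X (\<phi> n))) w) \<longlonglongrightarrow> poly (Polynomial.smult c (\<Prod>j\<in>{1..2*m}. [:- \<zeta> j, 1:])) w"
      unfolding P_factor poly_smult poly_prod c_def
      by (intro tendsto_intros) (auto intro!: tendsto_intros lim)
  qed
  then have "P lam = Polynomial.smult c (\<Prod>j\<in>{1..2*m}. [:- \<zeta> j, 1:])"
    by (intro poly_eqI_degree_lead_coeff poly_eq_poly_eq_iff[THEN iffD1] ext) auto
  then have "proots (P lam) = proots (\<Prod>j\<in>{1..2*m}. [:- \<zeta> j, 1:])"
    using a_bot by (simp add: c_def)
  also have "\<dots> = (\<Sum>j\<in>{1..2*m}. {#\<zeta> j#})"
    by (subst proots_prod) auto
  also have "\<dots> = image_mset \<zeta> (mset_set {1..2 * m})"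
    by (simp add: sum_unfold_sum_mset)
  finally have mset: "image_mset \<zeta> (mset_set {1..2 * m}) = proots (P lam)" ..
  have "cmod (\<zeta> j) = cmod (z j lam)" if "j \<in> {1..2*m}" for j
  proof (rule sorted_enumeration_unique[where u = "\<lambda>j. cmod (\<zeta> j)" and k = "2*m"])
    show "image_mset (\<lambda>j. cmod (\<zeta> j)) (mset_set {1..2*m}) =
          image_mset (\<lambda>j. cmod (z j lam)) (mset_set {1..2*m})"
      using arg_cong[OF trans[OF mset roots_mset[symmetric]], of "image_mset cmod"]
      by (simp add: image_mset.compositionality o_def)
    fix i j assume ij: "1 \<le> i" "i \<le> j" "j \<le> 2 * m"
    show "cmod (z i lam) \<le> cmod (z j lam)" using ij by (rule modulus_mono)
    show "cmod (\<zeta> i) \<le> cmod (\<zeta> j)"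
      using ij by (intro LIMSEQ_le[OF tendsto_norm[OF lim] tendsto_norm[OF lim]])
        (auto intro!: exI[of _ 0] modulus_mono)
  qed fact
  with \<phi> lim mset that show thesis by blast
qed

text \<open>
  The individual \<open>z j\<close> may jump, as roots of equal modulus come in any order. Their
  moduli do not: every sequence has a subsequence along which they converge to the right value.
\<close>

lemma isCont_modulus:
  assumes j: "j \<in> {1..2*m}"
  shows "isCont (\<lambda>lam. cmod (z j lam)) lam"
proof (rule ccontr)
  assume "\<not> isCont (\<lambda>lam. cmod (z j lam)) lam"
  then obtain e where e: "e > 0"
      and far: "\<And>d. d > 0 \<Longrightarrow> \<exists>l. dist l lam < d \<and> dist (cmod (z j l)) (cmod (z j lam)) \<ge> e"
    unfolding continuous_at_eps_delta dist_norm by (meson not_less)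
  have "\<exists>l. dist l lam < inverse (Suc n) \<and> dist (cmod (z j l)) (cmod (z j lam)) \<ge> e" for n
    by (rule far) simp
  then obtain X where X: "\<And>n. dist (X n) lam < inverse (real (Suc n))"
      and X': "\<And>n. dist (cmod (z j (X n))) (cmod (z j lam)) \<ge> e"
    by metis
  have "(\<lambda>n. dist (X n) lam) \<longlonglongrightarrow> 0"
  proof (rule tendsto_sandwich[OF _ _ tendsto_const LIMSEQ_inverse_real_of_nat])
    show "\<forall>\<^sub>F n in sequentially. dist (X n) lam \<le> inverse (real (Suc n))"
      by (intro always_eventually allI less_imp_le X)
  qed simp
  then have "X \<longlonglongrightarrow> lam"
    by (rule iffD2[OF tendsto_dist_iff])
  then obtain \<phi> \<zeta> where "\<And>j. j \<in> {1..2*m} \<Longrightarrow> (\<lambda>n. z j (X (\<phi> n))) \<longlonglongrightarrow> \<zeta> j"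
    "\<And>j. j \<in> {1..2*m} \<Longrightarrow> cmod (\<zeta> j) = cmod (z j lam)"
    using roots_subsequence by metis
  then have "(\<lambda>n. cmod (z j (X (\<phi> n)))) \<longlonglongrightarrow> cmod (z j lam)"
    using j by (metis tendsto_norm)
  then have "eventually (\<lambda>n. dist (cmod (z j (X (\<phi> n)))) (cmod (z j lam)) < e) sequentially"
    using e by (rule tendstoD)
  then show False
    using X' by (auto simp: eventually_sequentially not_less[symmetric])
qed

end

section \<open>No eigenvalues where the middle roots have different moduli\<close>

text \<open>
  The sum of \<open>cmod (coeff p i) * s ^ i\<close>, written as the value at \<open>s\<close>
  of a polynomial to give a recursion over \<open>pCons\<close>.
\<close>

definition weighted_norm :: "real \<Rightarrow> complex poly \<Rightarrow> real" where
  "weighted_norm s p = poly (map_poly cmod p) s"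

lemma weighted_norm_0 [simp]: "weighted_norm s 0 = 0"
  by (simp add: weighted_norm_def)

lemma weighted_norm_pCons [simp]: "weighted_norm s (pCons c p) = cmod c + s * weighted_norm s p"
  by (simp add: weighted_norm_def Polynomial.map_poly_pCons)

lemma weighted_norm_nonneg: "0 \<le> s \<Longrightarrow> 0 \<le> weighted_norm s p"
  by (induction p) auto

lemma weighted_norm_mono: "0 \<le> s \<Longrightarrow> s \<le> t \<Longrightarrow> weighted_norm s p \<le> weighted_norm t p"
  by (induction p) (auto intro!: mult_mono weighted_norm_nonneg)

lemma weighted_norm_add: "0 \<le> s \<Longrightarrow> weighted_norm s (p + q) \<le> weighted_norm s p + weighted_norm s q"
proof (induction p q rule: poly_induct2)
  case (pCons c p d q)
  have "cmod (c + d) + s * weighted_norm s (p + q)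
      \<le> (cmod c + cmod d) + s * (weighted_norm s p + weighted_norm s q)"
    using pCons by (intro add_mono mult_left_mono norm_triangle_ineq) auto
  then show ?case by (simp add: algebra_simps)
qed simp

lemma weighted_norm_smult: "weighted_norm s (Polynomial.smult c p) = cmod c * weighted_norm s p"
  by (induction p) (auto simp: norm_mult algebra_simps)

lemma norm_poly_le: "cmod (poly p w) \<le> weighted_norm (cmod w) p"
proof (induction p)
  case (pCons c p)
  have "cmod (poly (pCons c p) w) \<le> cmod c + cmod w * cmod (poly p w)"
    by (auto simp: norm_mult intro: order_trans[OF norm_triangle_ineq])
  also have "\<dots> \<le> cmod c + cmod w * weighted_norm (cmod w) p"
    using pCons by (intro add_left_mono mult_left_mono) auto
  finally show ?case by simp
qed simp

text \<open>
  Division by \<open>X - w\<close> costs a factor \<open>1 / (s - cmod w)\<close> only. The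
  subtracted norm at radius \<open>cmod w\<close> is what the induction over the coefficients
  needs: it absorbs the remainder that appears at each step.
\<close>

lemma weighted_norm_synthetic_div:
  assumes "0 \<le> s" "cmod w \<le> s"
  shows "(s - cmod w) * weighted_norm s (synthetic_div p w)
         \<le> weighted_norm s p - weighted_norm (cmod w) p"
proof (induction p)
  case (pCons c p)
  have "(s - cmod w) * weighted_norm s (synthetic_div (pCons c p) w)
      = (s - cmod w) * cmod (poly p w) + s * ((s - cmod w) * weighted_norm s (synthetic_div p w))"
    by (simp add: algebra_simps)
  also have "\<dots> \<le> (s - cmod w) * weighted_norm (cmod w) p
      + s * (weighted_norm s p - weighted_norm (cmod w) p)"
    using assms pCons by (intro add_mono mult_left_mono norm_poly_le) auto
  also have "\<dots> = weighted_norm s (pCons c p) - weighted_norm (cmod w) (pCons c p)"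
    by (simp add: algebra_simps)
  finally show ?case .
qed simp

text \<open>
  If a product of \<open>c\<close> linear factors divides \<open>p + g\<close> and
  \<open>p\<close> has degree below \<open>c\<close>, then \<open>p\<close> is minus the
  remainder of \<open>g\<close>. Peeling off one root at a time, as in Newton interpolation,
  bounds it by \<open>g\<close> with a constant that depends on the roots only through
  \<open>\<rho>\<close>; this uniformity is what later gives a neighbourhood of
  \<open>lam\<close> free of eigenvalues.
\<close>

lemma weighted_norm_remainder:
  assumes "0 \<le> \<rho>" "\<rho> < s"
  shows "\<exists>K\<ge>0. \<forall>J (w :: nat \<Rightarrow> complex) p g. finite J \<longrightarrow> card J = c \<longrightarrow> (p = 0 \<or> degree p < c) \<longrightarrow>
           (\<forall>j\<in>J. cmod (w j) \<le> \<rho>) \<longrightarrow> (\<Prod>j\<in>J. [:- w j, 1:]) dvd p + g \<longrightarrow>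
           weighted_norm s p \<le> K * weighted_norm s g"
proof (induction c)
  case 0
  show ?case by (intro exI[of _ 0]) auto
next
  case (Suc c)
  then obtain K where K: "K \<ge> 0" and IH: "\<And>J (w :: nat \<Rightarrow> complex) p g. finite J \<Longrightarrow> card J = c \<Longrightarrow>
      (p = 0 \<or> degree p < c) \<Longrightarrow> (\<forall>j\<in>J. cmod (w j) \<le> \<rho>) \<Longrightarrow> (\<Prod>j\<in>J. [:- w j, 1:]) dvd p + g \<Longrightarrow>
      weighted_norm s p \<le> K * weighted_norm s g"
    by blast
  have s: "0 < s" "0 \<le> s" using assms by auto
  show ?case
  proof (intro exI[of _ "1 + 2 * s * (K / (s - \<rho>))"] conjI allI impI)
    show "0 \<le> 1 + 2 * s * (K / (s - \<rho>))"
      using K s assms by auto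
    fix J and w :: "nat \<Rightarrow> complex" and p g
    assume J: "finite J" "card J = Suc c" and deg: "p = 0 \<or> degree p < Suc c"
      and w: "\<forall>j\<in>J. cmod (w j) \<le> \<rho>" and dvd: "(\<Prod>j\<in>J. [:- w j, 1:]) dvd p + g"
    obtain i J' where J': "J = insert i J'" "i \<notin> J'" "finite J'" "card J' = c"
      using J by (metis card_Suc_eq finite_insert)
    define p1 where "p1 = synthetic_div p (w i)"
    define g1 where "g1 = synthetic_div g (w i)"
    have p: "p = [:- w i, 1:] * p1 + [:poly p (w i):]" and g: "g = [:- w i, 1:] * g1 + [:poly g (w i):]"
      using synthetic_div_correct'[of "w i" p] synthetic_div_correct'[of "w i" g]
      by (auto simp: p1_def g1_def)
    have wi: "cmod (w i) \<le> \<rho>" using w J' by auto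
    have prod: "(\<Prod>j\<in>J. [:- w j, 1:]) = [:- w i, 1:] * (\<Prod>j\<in>J'. [:- w j, 1:])"
      using J' by simp
    have "[:- w i, 1:] dvd p + g"
      using dvd unfolding prod by (rule dvd_mult_left)
    then have val: "poly p (w i) = - poly g (w i)"
      using poly_eq_0_iff_dvd[of "p + g" "w i"] by (simp add: eq_neg_iff_add_eq_0)
    have "p + g = ([:- w i, 1:] * p1 + [:poly p (w i):]) + ([:- w i, 1:] * g1 + [:poly g (w i):])"
      using p g by metis
    also have "\<dots> = [:- w i, 1:] * (p1 + g1)"
      unfolding val by (simp add: algebra_simps smult_add_right)
    finally have "[:- w i, 1:] * (\<Prod>j\<in>J'. [:- w j, 1:]) dvd [:- w i, 1:] * (p1 + g1)"
      using dvd unfolding prod by metis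
    then have "(\<Prod>j\<in>J'. [:- w j, 1:]) dvd p1 + g1"
      by (subst (asm) dvd_mult_cancel_left) auto
    moreover have "p1 = 0 \<or> degree p1 < c"
      using deg unfolding p1_def degree_synthetic_div synthetic_div_eq_0_iff by (cases "degree p = 0") auto
    ultimately have "weighted_norm s p1 \<le> K * weighted_norm s g1"
      using J' w by (intro IH[where J = J' and w = w]) auto
    moreover have "weighted_norm s g1 \<le> weighted_norm s g / (s - \<rho>)"
    proof -
      have "(s - \<rho>) * weighted_norm s g1 \<le> (s - cmod (w i)) * weighted_norm s g1"
        using wi s by (intro mult_right_mono weighted_norm_nonneg) auto
      also have "\<dots> \<le> weighted_norm s g - weighted_norm (cmod (w i)) g"
        unfolding g1_def using wi s assms by (intro weighted_norm_synthetic_div) auto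
      also have "\<dots> \<le> weighted_norm s g"
        using weighted_norm_nonneg[of "cmod (w i)" g] by simp
      finally show ?thesis using assms by (simp add: field_simps)
    qed
    ultimately have p1: "weighted_norm s p1 \<le> K * (weighted_norm s g / (s - \<rho>))"
      using K by (meson mult_left_mono order_trans)
    have "weighted_norm s p \<le> weighted_norm s ([:- w i, 1:] * p1) + weighted_norm s [:poly p (w i):]"
      using p weighted_norm_add[OF s(2), of "[:- w i, 1:] * p1" "[:poly p (w i):]"] by simp
    also have "weighted_norm s ([:- w i, 1:] * p1)
        \<le> weighted_norm s (Polynomial.smult (- w i) p1) + weighted_norm s (pCons 0 p1)"
      using weighted_norm_add[OF s(2), of "Polynomial.smult (- w i) p1" "pCons 0 p1"] by simp
    also have "\<dots> = (cmod (w i) + s) * weighted_norm s p1"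
      by (simp add: weighted_norm_smult algebra_simps del: smult_minus_left)
    also have "\<dots> \<le> (2 * s) * (K * (weighted_norm s g / (s - \<rho>)))"
      using wi s assms K p1 by (intro mult_mono weighted_norm_nonneg) auto
    also have "weighted_norm s [:poly p (w i):] = cmod (poly g (w i))"
      unfolding val by simp
    also have "cmod (poly g (w i)) \<le> weighted_norm (cmod (w i)) g"
      by (rule norm_poly_le)
    also have "\<dots> \<le> weighted_norm s g"
      using wi assms by (intro weighted_norm_mono) auto
    finally show "weighted_norm s p \<le> (1 + 2 * s * (K / (s - \<rho>))) * weighted_norm s g"
      by (simp add: algebra_simps)
  qed
qed

lemma weighted_norm_altdef:
  assumes "\<And>i. N \<le> i \<Longrightarrow> coeff p i = 0"
  shows "weighted_norm s p = (\<Sum>i<N. cmod (coeff p i) * s ^ i)"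
  using assms
proof (induction N arbitrary: p)
  case 0
  then have "p = 0" by (intro poly_eqI) auto
  then show ?case by simp
next
  case (Suc N)
  obtain c q where p: "p = pCons c q" by (cases p) auto
  have "weighted_norm s q = (\<Sum>i<N. cmod (coeff q i) * s ^ i)"
    using Suc.prems[of "Suc _"] by (intro Suc.IH) (auto simp: p)
  then show ?case
    by (subst sum.lessThan_Suc_shift) (simp add: p sum_distrib_left mult_ac)
qed

text \<open>
  The high block of \<open>R\<close> carries the factor \<open>X ^ (m + n)\<close>, whose
  weighted norm is \<open>s ^ (m + n)\<close>, so the remainder estimate compares the two blocks
  up to that factor. The powers \<open>s ^ i\<close> with \<open>i < m\<close> only change the
  constant.
\<close>

lemma gap_low_part_bound:
  assumes "0 \<le> \<rho>" "\<rho> < s"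
  obtains C where "0 \<le> C"
    "\<And>n R J (w :: nat \<Rightarrow> complex). \<lbrakk>finite J; card J = m; \<And>j. j \<in> J \<Longrightarrow> cmod (w j) \<le> \<rho>;
       (\<Prod>j\<in>J. [:- w j, 1:]) dvd R; \<And>i. m \<le> i \<Longrightarrow> i < m + n \<Longrightarrow> coeff R i = 0;
       \<And>i. m + n + m \<le> i \<Longrightarrow> coeff R i = 0\<rbrakk> \<Longrightarrow>
       (\<Sum>i<m. cmod (coeff R i)) \<le> C * s ^ (m + n) * (\<Sum>i<m. cmod (coeff R (m + n + i)))"
proof -
  obtain K where K: "K \<ge> 0" and rem: "\<And>J (w :: nat \<Rightarrow> complex) p g. finite J \<Longrightarrow> card J = m \<Longrightarrow>
      (p = 0 \<or> degree p < m) \<Longrightarrow> (\<forall>j\<in>J. cmod (w j) \<le> \<rho>) \<Longrightarrow> (\<Prod>j\<in>J. [:- w j, 1:]) dvd p + g \<Longrightarrow>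
      weighted_norm s p \<le> K * weighted_norm s g"
    using weighted_norm_remainder[OF assms, of m] by blast
  have s: "0 < s" "0 \<le> s" using assms by auto
  define lo where "lo = min 1 s ^ m"
  define hi where "hi = max 1 s ^ m"
  have lo: "lo > 0" using s by (simp add: lo_def)
  have hi: "hi > 0" by (simp add: hi_def)
  have lo_le: "lo \<le> s ^ i" and hi_ge: "s ^ i \<le> hi" if "i < m" for i
  proof -
    have "min 1 s ^ m \<le> min 1 s ^ i" using s that by (intro power_decreasing) auto
    also have "\<dots> \<le> s ^ i" using s by (intro power_mono) auto
    finally show "lo \<le> s ^ i" by (simp add: lo_def)
    have "s ^ i \<le> max 1 s ^ i" using s by (intro power_mono) auto
    also have "\<dots> \<le> max 1 s ^ m" using that by (intro power_increasing) auto
    finally show "s ^ i \<le> hi" by (simp add: hi_def)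
  qed
  show thesis
  proof
    show "0 \<le> K * hi / lo" using K lo hi by simp
    fix n R J and w :: "nat \<Rightarrow> complex"
    assume J: "finite J" "card J = m" and w: "\<And>j. j \<in> J \<Longrightarrow> cmod (w j) \<le> \<rho>"
      and dvd: "(\<Prod>j\<in>J. [:- w j, 1:]) dvd R"
      and gap: "\<And>i. m \<le> i \<Longrightarrow> i < m + n \<Longrightarrow> coeff R i = 0"
      and top: "\<And>i. m + n + m \<le> i \<Longrightarrow> coeff R i = 0"
    define p where "p = poly_cutoff m R"
    define g where "g = R - p"
    have cp: "coeff p i = (if i < m then coeff R i else 0)" for i
      by (simp add: p_def coeff_poly_cutoff)
    have cg: "coeff g i = (if i < m then 0 else coeff R i)" for i
      by (simp add: g_def cp)
    have "p = 0 \<or> degree p < m"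
    proof (cases "p = 0")
      case False
      then show ?thesis using cp[of "degree p"] by (auto split: if_splits)
    qed simp
    then have "weighted_norm s p \<le> K * weighted_norm s g"
      using J w dvd by (intro rem[where J = J and w = w]) (auto simp: g_def)
    moreover have "weighted_norm s p = (\<Sum>i<m. cmod (coeff R i) * s ^ i)"
      by (subst weighted_norm_altdef[of m]) (auto simp: cp)
    moreover have "lo * (\<Sum>i<m. cmod (coeff R i)) \<le> (\<Sum>i<m. cmod (coeff R i) * s ^ i)"
      unfolding sum_distrib_left by (intro sum_mono, subst mult.commute) (auto intro!: mult_left_mono lo_le)
    moreover have "weighted_norm s g = (\<Sum>i<m. cmod (coeff R (m + n + i)) * s ^ (m + n + i))"
    proof -
      have split: "(\<Sum>i<k + l. h i) = (\<Sum>i<k. h i) + (\<Sum>i<l. h (k + i))" for k l :: nat and h :: "nat \<Rightarrow> real"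
        by (induction l) (auto simp: add_ac)
      have "weighted_norm s g = (\<Sum>i<m + n + m. cmod (coeff g i) * s ^ i)"
        by (rule weighted_norm_altdef) (auto simp: cg top)
      also have "\<dots> = (\<Sum>i<m + n. cmod (coeff g i) * s ^ i)
          + (\<Sum>i<m. cmod (coeff g (m + n + i)) * s ^ (m + n + i))"
        by (rule split)
      also have "(\<Sum>i<m + n. cmod (coeff g i) * s ^ i) = 0"
        by (intro sum.neutral) (auto simp: cg gap)
      finally show ?thesis by (simp add: cg)
    qed
    moreover have "(\<Sum>i<m. cmod (coeff R (m + n + i)) * s ^ (m + n + i))
        \<le> hi * s ^ (m + n) * (\<Sum>i<m. cmod (coeff R (m + n + i)))"
      unfolding sum_distrib_left
    proof (intro sum_mono)
      fix i assume "i \<in> {..<m}"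
      then have "cmod (coeff R (m + n + i)) * s ^ (m + n) * s ^ i
          \<le> cmod (coeff R (m + n + i)) * s ^ (m + n) * hi"
        using s hi_ge by (intro mult_left_mono) auto
      then show "cmod (coeff R (m + n + i)) * s ^ (m + n + i) \<le> hi * s ^ (m + n) * cmod (coeff R (m + n + i))"
        by (simp add: power_add mult_ac)
    qed
    ultimately have "lo * (\<Sum>i<m. cmod (coeff R i))
        \<le> K * (hi * s ^ (m + n) * (\<Sum>i<m. cmod (coeff R (m + n + i))))"
      using K by (smt (verit) mult_left_mono)
    then show "(\<Sum>i<m. cmod (coeff R i)) \<le> K * hi / lo * s ^ (m + n) * (\<Sum>i<m. cmod (coeff R (m + n + i)))"
      using lo by (simp add: field_simps)
  qed
qed

text \<open>
  Reversal with respect to a prescribed degree \<open>d\<close>: \<open>reflect_poly\<close>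
  reverses with respect to the actual degree, which may be smaller because top coefficients may
  vanish.
\<close>

definition reverse_poly :: "nat \<Rightarrow> complex poly \<Rightarrow> complex poly" where
  "reverse_poly d R = monom 1 (d - degree R) * reflect_poly R"

lemma coeff_reverse_poly:
  assumes "degree R \<le> d"
  shows "coeff (reverse_poly d R) i = (if i \<le> d then coeff R (d - i) else 0)"
  using assms by (auto simp: reverse_poly_def coeff_monom_mult coeff_reflect_poly coeff_eq_0)

lemma reverse_poly_dvd:
  fixes v :: "nat \<Rightarrow> complex"
  assumes "(\<Prod>j\<in>J. [:- v j, 1:]) dvd R" "\<And>j. j \<in> J \<Longrightarrow> v j \<noteq> 0"
  shows "(\<Prod>j\<in>J. [:- (1 / v j), 1:]) dvd reverse_poly d R"
proof -
  have "[:- (1 / v j), 1:] dvd reflect_poly [:- v j, 1:]" if "j \<in> J" for j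
  proof -
    have "reflect_poly [:- v j, 1:] = [:- (1 / v j), 1:] * [:- v j:]"
      using assms(2)[OF that] by (simp add: reflect_poly_def)
    then show ?thesis by (metis dvd_triv_left)
  qed
  then have "(\<Prod>j\<in>J. [:- (1 / v j), 1:]) dvd (\<Prod>j\<in>J. reflect_poly [:- v j, 1:])"
    by (rule prod_dvd_prod)
  also have "\<dots> = reflect_poly (\<Prod>j\<in>J. [:- v j, 1:])"
    by (rule reflect_poly_prod[symmetric])
  also have "\<dots> dvd reflect_poly R"
    using assms(1) by (metis dvdE dvd_triv_left reflect_poly_mult)
  also have "\<dots> dvd reverse_poly d R"
    by (simp add: reverse_poly_def)
  finally show ?thesis .
qed

context laurent_symbol
begin

text \<open>
  The entries do not depend on the size of the matrix, which lets row sums be estimated for all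
  sizes at once.
\<close>

definition entry :: "nat \<Rightarrow> nat \<Rightarrow> complex" where
  "entry i j = (if \<bar>int i - int j\<bar> \<le> int m then complex_of_real (a (int i - int j)) else 0)"

lemma toeplitz_carrier [simp]: "toeplitz a m n \<in> carrier_mat n n"
  by (simp add: toeplitz_def)

lemma toeplitz_entry [simp]: "i < n \<Longrightarrow> j < n \<Longrightarrow> toeplitz a m n $$ (i, j) = entry i j"
  by (simp add: toeplitz_def entry_def)

lemma spectrum_toeplitzE:
  assumes "lam \<in> spectrum (toeplitz a m n)"
  obtains v where "\<exists>i<n. v i \<noteq> 0" "\<And>i. i < n \<Longrightarrow> (\<Sum>j<n. entry i j * v j) = lam * v i"
proof -
  obtain v where v: "v \<in> carrier_vec n" "v \<noteq> 0\<^sub>v n" "toeplitz a m n *\<^sub>v v = lam \<cdot>\<^sub>v v"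
    using assms unfolding spectrum_def eigenvalue_def eigenvector_def by (auto simp: toeplitz_def)
  show thesis
  proof (rule that[of "vec_index v"])
    show "\<exists>i<n. vec_index v i \<noteq> 0"
      using v by (metis eq_vecI carrier_vecD index_zero_vec)
    fix i assume i: "i < n"
    have "vec_index (toeplitz a m n *\<^sub>v v) i = (\<Sum>j<n. entry i j * vec_index v j)"
      using i v(1) by (auto simp: mult_mat_vec_def scalar_prod_def toeplitz_def entry_def
          atLeast0LessThan intro!: sum.cong)
    then show "(\<Sum>j<n. entry i j * vec_index v j) = lam * vec_index v i"
      using v i by simp
  qed
qed

text \<open>
  The Wiener norm of the symbol; it bounds the row sums, and hence the eigenvalues, of all
  Toeplitz matrices.
\<close>

definition symbol_norm :: real where "symbol_norm = (\<Sum>k\<in>{- int m..int m}. \<bar>a k\<bar>)"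

lemma entry_row_sum: "(\<Sum>j<n. cmod (entry i j)) \<le> symbol_norm"
proof -
  have "(\<Sum>j<n. cmod (entry i j)) = (\<Sum>j\<in>{j. j < n \<and> \<bar>int i - int j\<bar> \<le> int m}. \<bar>a (int i - int j)\<bar>)"
    by (rule sum.mono_neutral_cong_right) (auto simp: entry_def)
  also have "\<dots> = (\<Sum>k\<in>(\<lambda>j. int i - int j) ` {j. j < n \<and> \<bar>int i - int j\<bar> \<le> int m}. \<bar>a k\<bar>)"
    by (subst sum.reindex) (auto simp: inj_on_def)
  also have "\<dots> \<le> symbol_norm"
    unfolding symbol_norm_def by (rule sum_mono2) auto
  finally show ?thesis .
qed

text \<open>
  Compare both sides of the eigenvalue equation in a row where the eigenvector is largest.
\<close>

lemma spectrum_bound: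
  assumes "lam \<in> spectrum (toeplitz a m n)"
  shows "cmod lam \<le> symbol_norm"
proof -
  obtain v where v: "\<exists>i<n. v i \<noteq> 0" "\<And>i. i < n \<Longrightarrow> (\<Sum>j<n. entry i j * v j) = lam * v i"
    using spectrum_toeplitzE[OF assms] by metis
  define M where "M = Max ((\<lambda>i. cmod (v i)) ` {..<n})"
  have ne: "{..<n} \<noteq> {}" using v(1) by auto
  have le: "cmod (v j) \<le> M" if "j < n" for j
    using that unfolding M_def by (intro Max_ge) auto
  have "M \<in> (\<lambda>i. cmod (v i)) ` {..<n}"
    unfolding M_def using ne by (intro Max_in) auto
  then obtain i where i: "i < n" "M = cmod (v i)" by auto
  have "M > 0" using v(1) le by (metis less_le_trans zero_less_norm_iff)
  have "cmod lam * M = cmod (\<Sum>j<n. entry i j * v j)"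
    using v(2)[OF i(1)] i(2) by (simp add: norm_mult)
  also have "\<dots> \<le> (\<Sum>j<n. cmod (entry i j) * M)"
    by (intro sum_norm_le) (auto simp: norm_mult intro!: mult_left_mono le)
  also have "\<dots> \<le> symbol_norm * M"
    unfolding sum_distrib_right[symmetric] using \<open>M > 0\<close> by (intro mult_right_mono entry_row_sum) auto
  finally show ?thesis using \<open>M > 0\<close> by simp
qed

text \<open>
  Let \<open>V\<close> have the eigenvector as coefficients, in reverse order because the
  exponents in the symbol are negated. The eigenvalue equation says precisely that the
  \<open>n\<close> middle coefficients of \<open>V * P lam\<close> vanish.
\<close>

lemma spectrum_imp_gap_multiple:
  assumes "lam \<in> spectrum (toeplitz a m n)"
  obtains R where "R \<noteq> 0" "P lam dvd R" "degree R < m + n + m"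
    "\<And>i. m \<le> i \<Longrightarrow> i < m + n \<Longrightarrow> coeff R i = 0"
proof -
  obtain v where v: "\<exists>i<n. v i \<noteq> 0" "\<And>i. i < n \<Longrightarrow> (\<Sum>j<n. entry i j * v j) = lam * v i"
    using spectrum_toeplitzE[OF assms] by metis
  define V where "V = (\<Sum>j<n. monom (v j) (n - 1 - j))"
  have n: "n > 0" using v(1) by auto
  have "V \<noteq> 0"
  proof
    assume V: "V = 0"
    obtain i where i: "i < n" "v i \<noteq> 0" using v(1) by auto
    have "coeff V (n - 1 - i) = (\<Sum>j<n. if j = i then v j else 0)"
      unfolding V_def coeff_sum using i by (intro sum.cong) auto
    also have "\<dots> = v i" using i by (subst sum.delta) auto
    finally show False using V i by simp
  qed
  show thesis
  proof
    show "V * P lam \<noteq> 0" using \<open>V \<noteq> 0\<close> by simp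
    show "P lam dvd V * P lam" by simp
    have "degree V \<le> n - 1"
      unfolding V_def by (intro degree_sum_le) (auto intro: order_trans[OF degree_monom_le])
    then show "degree (V * P lam) < m + n + m"
      using n by (simp add: degree_mult_eq \<open>V \<noteq> 0\<close> degree_P)
    fix l assume l: "m \<le> l" "l < m + n"
    define i where "i = m + n - 1 - l"
    have i: "i < n" "l = m + n - 1 - i" using l by (auto simp: i_def)
    have "coeff (V * P lam) l = (\<Sum>j<n. coeff (monom (v j) (n - 1 - j) * P lam) l)"
      unfolding V_def sum_distrib_right coeff_sum ..
    also have "\<dots> = (\<Sum>j<n. entry i j * v j - (if j = i then lam * v j else 0))"
    proof (intro sum.cong refl)
      fix j assume j: "j \<in> {..<n}"
      show "coeff (monom (v j) (n - 1 - j) * P lam) l = entry i j * v j - (if j = i then lam * v j else 0)"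
      proof (cases "i \<le> m + j")
        case True
        have e: "l - (n - 1 - j) = m + j - i" "n - 1 - j \<le> l" using i j True by auto
        have "int m - int (m + j - i) = int i - int j" using True by auto
        moreover have "m + j - i \<le> 2 * m \<longleftrightarrow> \<bar>int i - int j\<bar> \<le> int m" using True by auto
        moreover have "m + j - i = m \<longleftrightarrow> j = i" using True by auto
        ultimately show ?thesis
          unfolding coeff_monom_mult coeff_P e(1) using e(2)
          by (simp only: if_True entry_def right_diff_distrib mult.commute[of _ "v j"] if_distrib[of "(*) (v j)"]
              mult_zero_right cong: if_cong) (auto simp: mult.commute)
      next
        case False
        then have "\<not> n - 1 - j \<le> l" using i j by auto
        then show ?thesis using False by (simp add: coeff_monom_mult entry_def)
      qed
    qed
    also have "\<dots> = 0"
      unfolding sum_subtractf using v(2)[OF i(1)] i(1) by (simp add: sum.delta)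
    finally show "coeff (V * P lam) l = 0" .
  qed
qed

end

context sorted_symbol
begin

text \<open>
  Let \<open>A\<close> and \<open>B\<close> be the sums of the moduli in the low and the high
  block of the multiple \<open>R\<close>. The \<open>m\<close> small roots give \<open>A \<le> C
  * s ^ (m + n) * B\<close>, the \<open>m\<close> large roots (whose inverses are roots of the
  reversed polynomial) give \<open>B \<le> D * t ^ (m + n) * A\<close>, and \<open>s * t <
  1\<close>, so that \<open>A = B = 0\<close> once \<open>n\<close> is large.
\<close>

lemma spectrum_excluded_by_modulus_gap:
  assumes "0 \<le> \<rho>1" "\<rho>1 < \<rho>2"
  obtains N where "\<And>n lam. N \<le> n \<Longrightarrow> cmod (z m lam) \<le> \<rho>1 \<Longrightarrow> \<rho>2 \<le> cmod (z (m + 1) lam) \<Longrightarrow>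
     lam \<notin> spectrum (toeplitz a m n)"
proof -
  obtain s s' where s: "\<rho>1 < s" "s < s'" "s' < \<rho>2"
    using assms by (meson dense)
  define t where "t = 1 / s'"
  have pos: "0 < s" "0 < s'" "0 < t" "0 < \<rho>2" using s assms by (auto simp: t_def)
  have st: "s * t < 1" "0 < s * t" using s pos by (auto simp: t_def)
  have t: "0 \<le> 1 / \<rho>2" "1 / \<rho>2 < t"
    using s pos by (auto simp: t_def frac_less2)
  obtain C where C: "0 \<le> C"
    "\<And>n R J (w :: nat \<Rightarrow> complex). \<lbrakk>finite J; card J = m; \<And>j. j \<in> J \<Longrightarrow> cmod (w j) \<le> \<rho>1;
       (\<Prod>j\<in>J. [:- w j, 1:]) dvd R; \<And>i. m \<le> i \<Longrightarrow> i < m + n \<Longrightarrow> coeff R i = 0;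
       \<And>i. m + n + m \<le> i \<Longrightarrow> coeff R i = 0\<rbrakk> \<Longrightarrow>
       (\<Sum>i<m. cmod (coeff R i)) \<le> C * s ^ (m + n) * (\<Sum>i<m. cmod (coeff R (m + n + i)))"
    using gap_low_part_bound[OF assms(1) s(1), of m] by metis
  obtain D where D: "0 \<le> D"
    "\<And>n R J (w :: nat \<Rightarrow> complex). \<lbrakk>finite J; card J = m; \<And>j. j \<in> J \<Longrightarrow> cmod (w j) \<le> 1 / \<rho>2;
       (\<Prod>j\<in>J. [:- w j, 1:]) dvd R; \<And>i. m \<le> i \<Longrightarrow> i < m + n \<Longrightarrow> coeff R i = 0;
       \<And>i. m + n + m \<le> i \<Longrightarrow> coeff R i = 0\<rbrakk> \<Longrightarrow>
       (\<Sum>i<m. cmod (coeff R i)) \<le> D * t ^ (m + n) * (\<Sum>i<m. cmod (coeff R (m + n + i)))"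
    using gap_low_part_bound[OF t, of m] by metis
  have "(\<lambda>n. C * D * (s * t) ^ n) \<longlonglongrightarrow> C * D * 0"
    using st by (intro tendsto_intros LIMSEQ_power_zero) auto
  then have "eventually (\<lambda>n. C * D * (s * t) ^ n < 1) sequentially"
    by (intro order_tendstoD) auto
  then obtain N where N: "\<And>n. N \<le> n \<Longrightarrow> C * D * (s * t) ^ n < 1"
    by (auto simp: eventually_sequentially)
  show thesis
  proof (rule that[of N], rule notI)
    fix n lam
    assume n: "N \<le> n" and small: "cmod (z m lam) \<le> \<rho>1" and large: "\<rho>2 \<le> cmod (z (m + 1) lam)"
      and "lam \<in> spectrum (toeplitz a m n)"
    then obtain R where R: "R \<noteq> 0" "P lam dvd R" "degree R < m + n + m"
      "\<And>i. m \<le> i \<Longrightarrow> i < m + n \<Longrightarrow> coeff R i = 0"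
      using spectrum_imp_gap_multiple by metis
    have top: "coeff R i = 0" if "m + n + m \<le> i" for i
      using R(3) that by (intro coeff_eq_0) auto
    have sub: "(\<Prod>j\<in>J. [:- z j lam, 1:]) dvd R" if "J \<subseteq> {1..2*m}" for J
    proof -
      have "(\<Prod>j\<in>J. [:- z j lam, 1:]) dvd (\<Prod>j\<in>{1..2*m}. [:- z j lam, 1:])"
        using that by (intro prod_dvd_prod_subset) auto
      also have "\<dots> dvd P lam" by (subst P_factor) (rule dvd_smult, rule dvd_refl)
      finally show ?thesis using R(2) by (rule dvd_trans)
    qed
    define A where "A = (\<Sum>i<m. cmod (coeff R i))"
    define B where "B = (\<Sum>i<m. cmod (coeff R (m + n + i)))"
    have AB: "A \<ge> 0" "B \<ge> 0" by (auto simp: A_def B_def intro: sum_nonneg)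
    have "A \<le> C * s ^ (m + n) * B"
      unfolding A_def B_def
    proof (rule C(2)[of "{1..m}" "\<lambda>j. z j lam"])
      fix j assume "j \<in> {1..m}"
      then show "cmod (z j lam) \<le> \<rho>1"
        using small modulus_mono[of j m lam] by force
    qed (use R(4) top sub in auto)
    (* the largest degree that R may have *)
    define d where "d = m + n + m - 1"
    define S where "S = reverse_poly d R"
    have S: "coeff S i = (if i \<le> d then coeff R (d - i) else 0)" for i
      unfolding S_def using R(3) by (intro coeff_reverse_poly) (auto simp: d_def)
    have flip: "(\<Sum>i<m. cmod (coeff S i)) = B" "(\<Sum>i<m. cmod (coeff S (m + n + i))) = A"
    proof -
      have "(\<Sum>i<m. cmod (coeff S i)) = (\<Sum>i<m. cmod (coeff S (m - Suc i)))"
        by (rule sum.nat_diff_reindex[symmetric])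
      also have "\<dots> = B" unfolding B_def
      proof (intro sum.cong refl arg_cong[where f = cmod])
        fix i assume "i \<in> {..<m}"
        then have "m - Suc i \<le> d" "d - (m - Suc i) = m + n + i" by (auto simp: d_def)
        then show "coeff S (m - Suc i) = coeff R (m + n + i)" by (simp add: S)
      qed
      finally show "(\<Sum>i<m. cmod (coeff S i)) = B" .
      have "(\<Sum>i<m. cmod (coeff S (m + n + i))) = (\<Sum>i<m. cmod (coeff S (m + n + (m - Suc i))))"
        by (rule sum.nat_diff_reindex[symmetric])
      also have "\<dots> = A" unfolding A_def
      proof (intro sum.cong refl arg_cong[where f = cmod])
        fix i assume "i \<in> {..<m}"
        then have "m + n + (m - Suc i) \<le> d" "d - (m + n + (m - Suc i)) = i" by (auto simp: d_def)
        then show "coeff S (m + n + (m - Suc i)) = coeff R i" by (simp add: S)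
      qed
      finally show "(\<Sum>i<m. cmod (coeff S (m + n + i))) = A" .
    qed
    have "(\<Sum>i<m. cmod (coeff S i)) \<le> D * t ^ (m + n) * (\<Sum>i<m. cmod (coeff S (m + n + i)))"
    proof (rule D(2)[of "{m+1..2*m}" "\<lambda>j. 1 / z j lam"])
      have ge: "\<rho>2 \<le> cmod (z j lam)" if "j \<in> {m+1..2*m}" for j
      proof -
        have "cmod (z (m + 1) lam) \<le> cmod (z j lam)"
          using that by (intro modulus_mono) auto
        then show ?thesis using large by linarith
      qed
      show "cmod (1 / z j lam) \<le> 1 / \<rho>2" if "j \<in> {m+1..2*m}" for j
        using ge[OF that] pos by (auto simp: norm_divide intro!: divide_left_mono mult_pos_pos)
      show "(\<Prod>j\<in>{m+1..2*m}. [:- (1 / z j lam), 1:]) dvd S"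
        unfolding S_def
      proof (rule reverse_poly_dvd[OF sub])
        show "z j lam \<noteq> 0" if "j \<in> {m+1..2*m}" for j
          using ge[OF that] pos by auto
      qed auto
      show "coeff S i = 0" if "m \<le> i" "i < m + n" for i
        using that R(4)[of "d - i"] by (auto simp: S d_def)
      show "coeff S i = 0" if "m + n + m \<le> i" for i
        using that m_pos by (auto simp: S d_def)
    qed auto
    then have BA: "B \<le> D * t ^ (m + n) * A" unfolding flip .
    have "A \<le> C * s ^ (m + n) * B" by fact
    also have "\<dots> \<le> C * s ^ (m + n) * (D * t ^ (m + n) * A)"
      using BA C(1) pos by (intro mult_left_mono) auto
    also have "\<dots> = (C * D * (s * t) ^ (m + n)) * A"
      by (simp add: power_mult_distrib mult_ac)
    finally have "A \<le> (C * D * (s * t) ^ (m + n)) * A" .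
    moreover have "C * D * (s * t) ^ (m + n) < 1"
      using n by (intro N) auto
    then have "C * D * (s * t) ^ (m + n) * A < 1 * A" if "A > 0"
      using that by (rule mult_strict_right_mono)
    ultimately have "A = 0"
      using AB(1) by (cases "A = 0") auto
    then have "B = 0" using BA AB by simp
    have "coeff R i = 0" for i
    proof -
      consider "i < m" | "m \<le> i" "i < m + n" | "m + n \<le> i" "i < m + n + m" | "m + n + m \<le> i"
        by linarith
      then show ?thesis
      proof cases
        case 1
        then show ?thesis using \<open>A = 0\<close> by (simp add: A_def sum_nonneg_eq_0_iff)
      next
        case 3
        then obtain i' where "i = m + n + i'" "i' < m"
          by (metis add_less_cancel_left le_Suc_ex)
        then show ?thesis using \<open>B = 0\<close> by (simp add: B_def sum_nonneg_eq_0_iff)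
      qed (use R(4) top in auto)
    qed
    then have "R = 0" by (intro poly_eqI) auto
    then show False using R(1) by simp
  qed
qed

end

section \<open>Traces of powers and density of the eigenvalues\<close>

definition mat_trace :: "complex mat \<Rightarrow> complex" where
  "mat_trace A = (\<Sum>i<dim_row A. A $$ (i, i))"

lemma mat_trace_comm:
  assumes "A \<in> carrier_mat n n" "B \<in> carrier_mat n n"
  shows "mat_trace (A * B) = mat_trace (B * A)"
proof -
  have *: "mat_trace (X * Y) = (\<Sum>i<n. \<Sum>j<n. X $$ (i, j) * Y $$ (j, i))"
    if "X \<in> carrier_mat n n" "Y \<in> carrier_mat n n" for X Y
    unfolding mat_trace_def using that
    by (intro sum.cong) (auto simp: scalar_prod_def atLeast0LessThan)
  show ?thesis
    unfolding *[OF assms] *[OF assms(2,1)] by (subst sum.swap) (simp add: mult.commute)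
qed

lemma upper_triangular_pow:
  fixes B :: "complex mat"
  assumes B: "B \<in> carrier_mat n n" "upper_triangular B"
  shows "i < n \<Longrightarrow> j \<le> i \<Longrightarrow> (B ^\<^sub>m k) $$ (i, j) = (if i = j then (B $$ (i, i)) ^ k else 0)"
proof (induction k arbitrary: i j)
  case 0
  then show ?case using B by auto
next
  case (Suc k)
  have dim: "B ^\<^sub>m k \<in> carrier_mat n n" using B by simp
  have "(B ^\<^sub>m Suc k) $$ (i, j) = (\<Sum>l<n. (B ^\<^sub>m k) $$ (i, l) * B $$ (l, j))"
    using Suc.prems B dim by (auto simp: scalar_prod_def atLeast0LessThan intro!: sum.cong)
  also have "\<dots> = (\<Sum>l<n. if l = i then (B $$ (i, i)) ^ k * B $$ (i, j) else 0)"
  proof (intro sum.cong refl)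
    fix l assume l: "l \<in> {..<n}"
    consider "l < i" | "l = i" | "i < l" by linarith
    then show "(B ^\<^sub>m k) $$ (i, l) * B $$ (l, j) = (if l = i then (B $$ (i, i)) ^ k * B $$ (i, j) else 0)"
    proof cases
      case 3
      then have "B $$ (l, j) = 0" using B l Suc.prems by (intro upper_triangularD) auto
      then show ?thesis using 3 by simp
    qed (use Suc l in auto)
  qed
  also have "\<dots> = (B $$ (i, i)) ^ k * B $$ (i, j)"
    using Suc.prems by (simp add: sum.delta)
  also have "\<dots> = (if i = j then (B $$ (i, i)) ^ Suc k else 0)"
    using upper_triangularD[OF B(2), of j i] B(1) Suc.prems by auto
  finally show ?case .
qed

text \<open>
  The list of eigenvalues with multiplicity is the diagonal of a Schur triangularisation, and
  powers of a triangular matrix have the powers of the diagonal entries on the diagonal.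
\<close>

lemma trace_power_eigenvalues:
  fixes A :: "complex mat"
  assumes A: "A \<in> carrier_mat n n"
  obtains es where "length es = n" "set es = spectrum A"
    "\<And>k. mat_trace (A ^\<^sub>m k) = (\<Sum>e\<leftarrow>es. e ^ k)"
proof -
  obtain es where cp: "char_poly A = (\<Prod>e\<leftarrow>es. [:- e, 1:])" and len: "length es = n"
    using char_poly_factorized[OF A] by auto
  obtain B P Q where BPQ: "schur_decomposition A es = (B, P, Q)"
    by (cases "schur_decomposition A es") auto
  have sim: "similar_mat_wit A B P Q" and ut: "upper_triangular B" and diag: "diag_mat B = es"
    using schur_decomposition[OF A cp BPQ] by auto
  note w = similar_mat_witD2[OF A sim]
  have tr: "mat_trace (A ^\<^sub>m k) = (\<Sum>e\<leftarrow>es. e ^ k)" for k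
  proof -
    have Bk: "B ^\<^sub>m k \<in> carrier_mat n n" using w by simp
    have "A ^\<^sub>m k = P * (B ^\<^sub>m k * Q)"
      unfolding similar_mat_wit_pow_id[OF sim] using w Bk by (intro assoc_mult_mat) auto
    then have "mat_trace (A ^\<^sub>m k) = mat_trace (P * (B ^\<^sub>m k * Q))"
      by (rule arg_cong)
    also have "\<dots> = mat_trace (B ^\<^sub>m k * Q * P)"
      using w Bk by (intro mat_trace_comm[of P n]) auto
    also have "B ^\<^sub>m k * Q * P = B ^\<^sub>m k * (Q * P)"
      using w Bk by (intro assoc_mult_mat) auto
    also have "\<dots> = B ^\<^sub>m k" using w Bk by simp
    also have "mat_trace \<dots> = (\<Sum>i<n. (B $$ (i, i)) ^ k)"
      unfolding mat_trace_def using Bk w(5) upper_triangular_pow[OF w(5) ut] by (intro sum.cong) auto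
    also have "\<dots> = (\<Sum>e\<leftarrow>es. e ^ k)"
      using w(5) unfolding diag[symmetric]
      by (simp add: diag_mat_def sum_list_sum_nth atLeast0LessThan o_def)
    finally show ?thesis .
  qed
  have "set es = spectrum A"
    unfolding spectrum_root_char_poly[OF A] cp by (auto simp: poly_prod_list prod_list_zero_iff)
  with len tr that show thesis by blast
qed

context laurent_symbol
begin

text \<open>
  The coefficients of the powers of the symbol, by convolution.
\<close>

fun power_coeff :: "nat \<Rightarrow> int \<Rightarrow> complex" where
  "power_coeff 0 d = (if d = 0 then 1 else 0)"
| "power_coeff (Suc k) d = (\<Sum>l\<in>{- int m..int m}. complex_of_real (a l) * power_coeff k (d - l))"

lemma power_coeff_eq_0: "int (k * m) < \<bar>d\<bar> \<Longrightarrow> power_coeff k d = 0"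
proof (induction k arbitrary: d)
  case (Suc k)
  have "power_coeff k (d - l) = 0" if "l \<in> {- int m..int m}" for l
    using Suc.prems that by (intro Suc.IH) auto
  then show ?case by simp
qed auto

lemma f_power:
  assumes "w \<noteq> 0"
  shows "f w ^ k = (\<Sum>d\<in>{- int (k * m)..int (k * m)}. power_coeff k d * w powi (- d))"
proof (induction k)
  case (Suc k)
  let ?I = "\<lambda>k. {- int (k * m)..int (k * m)}"
  have shift: "(\<Sum>d\<in>?I k. power_coeff k d * w powi (- d)) * w powi (- l)
      = (\<Sum>d\<in>?I (Suc k). power_coeff k (d - l) * w powi (- d))" if l: "l \<in> {- int m..int m}" for l
  proof -
    have "(\<Sum>d\<in>?I k. power_coeff k d * w powi (- d)) * w powi (- l)
        = (\<Sum>d\<in>?I k. power_coeff k (d + l - l) * w powi (- (d + l)))"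
      unfolding sum_distrib_right using assms power_int_add[of w "- _" "- l"]
      by (intro sum.cong) (auto simp: mult_ac)
    also have "\<dots> = (\<Sum>d\<in>(\<lambda>d. d + l) ` ?I k. power_coeff k (d - l) * w powi (- d))"
      by (subst sum.reindex) (auto simp: inj_on_def)
    also have "\<dots> = (\<Sum>d\<in>?I (Suc k). power_coeff k (d - l) * w powi (- d))"
    proof (rule sum.mono_neutral_left)
      show "(\<lambda>d. d + l) ` ?I k \<subseteq> ?I (Suc k)" using l by auto
      show "\<forall>d\<in>?I (Suc k) - (\<lambda>d. d + l) ` ?I k. power_coeff k (d - l) * w powi (- d) = 0"
      proof
        fix d assume d: "d \<in> ?I (Suc k) - (\<lambda>d. d + l) ` ?I k"
        have "d - l \<notin> ?I k"
        proof
          assume "d - l \<in> ?I k"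
          then have "(d - l) + l \<in> (\<lambda>d. d + l) ` ?I k" by (rule imageI)
          then show False using d by simp
        qed
        then have "power_coeff k (d - l) = 0" by (intro power_coeff_eq_0) auto
        then show "power_coeff k (d - l) * w powi (- d) = 0" by simp
      qed
    qed auto
    finally show ?thesis .
  qed
  define S where "S = (\<Sum>d\<in>?I k. power_coeff k d * w powi (- d))"
  have "f w ^ Suc k = f w * S"
    using Suc by (simp add: S_def)
  also have "\<dots> = (\<Sum>l\<in>{- int m..int m}. complex_of_real (a l) * (S * w powi (- l)))"
    unfolding laurent_def sum_distrib_right by (intro sum.cong) (auto simp: mult_ac)
  also have "\<dots> = (\<Sum>l\<in>{- int m..int m}. \<Sum>d\<in>?I (Suc k).
      complex_of_real (a l) * power_coeff k (d - l) * w powi (- d))"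
  proof (intro sum.cong refl)
    fix l assume l: "l \<in> {- int m..int m}"
    show "complex_of_real (a l) * (S * w powi (- l)) = (\<Sum>d\<in>?I (Suc k).
      complex_of_real (a l) * power_coeff k (d - l) * w powi (- d))"
      unfolding S_def shift[OF l] sum_distrib_left by (simp only: mult.assoc)
  qed
  also have "\<dots> = (\<Sum>d\<in>?I (Suc k). power_coeff (Suc k) d * w powi (- d))"
    by (subst sum.swap) (simp add: sum_distrib_right)
  finally show ?case .
qed simp

lemma toeplitz_pow_carrier [simp]: "toeplitz a m n ^\<^sub>m k \<in> carrier_mat n n"
  by (rule pow_carrier_mat) simp

lemma toeplitz_pow_Suc:
  assumes "i < n" "j < n"
  shows "(toeplitz a m n ^\<^sub>m Suc k) $$ (i, j) = (\<Sum>l<n. (toeplitz a m n ^\<^sub>m k) $$ (i, l) * entry l j)"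
proof -
  note c = toeplitz_carrier[of n] toeplitz_pow_carrier[of n k]
  have "(toeplitz a m n ^\<^sub>m Suc k) $$ (i, j)
      = (\<Sum>l<n. (toeplitz a m n ^\<^sub>m k) $$ (i, l) * toeplitz a m n $$ (l, j))"
    using assms c carrier_matD[OF c(1)] carrier_matD[OF c(2)]
    by (auto simp: scalar_prod_def atLeast0LessThan intro!: sum.cong)
  also have "\<dots> = (\<Sum>l<n. (toeplitz a m n ^\<^sub>m k) $$ (i, l) * entry l j)"
    using assms by (intro sum.cong) auto
  finally show ?thesis .
qed

text \<open>
  Multiplying banded Toeplitz matrices agrees with multiplying the symbols as long as the band
  is not cut off by the border of the matrix; each factor spoils \<open>m\<close> further
  columns at both ends.
\<close>

lemma toeplitz_pow_interior:
  "i < n \<Longrightarrow> k * m \<le> j \<Longrightarrow> j + k * m < n \<Longrightarrow>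
     (toeplitz a m n ^\<^sub>m k) $$ (i, j) = power_coeff k (int i - int j)"
proof (induction k arbitrary: j)
  case 0
  then show ?case using carrier_matD[OF toeplitz_carrier[of n]] by auto
next
  case (Suc k)
  let ?L = "{l. l < n \<and> \<bar>int l - int j\<bar> \<le> int m}"
  have "(toeplitz a m n ^\<^sub>m Suc k) $$ (i, j) = (\<Sum>l<n. (toeplitz a m n ^\<^sub>m k) $$ (i, l) * entry l j)"
    using Suc.prems by (intro toeplitz_pow_Suc) auto
  also have "\<dots> = (\<Sum>l\<in>?L. power_coeff k (int i - int l) * complex_of_real (a (int l - int j)))"
    using Suc.prems by (intro sum.mono_neutral_cong_right) (auto simp: entry_def Suc.IH)
  also have "\<dots> = (\<Sum>d\<in>(\<lambda>l. int l - int j) ` ?L. complex_of_real (a d) * power_coeff k (int i - int j - d))"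
    by (subst sum.reindex) (auto simp: inj_on_def mult_ac intro!: sum.cong)
  also have "(\<lambda>l. int l - int j) ` ?L = {- int m..int m}"
  proof (intro equalityI subsetI)
    fix d assume d: "d \<in> {- int m..int m}"
    have "m \<le> j" "j + m < n" using Suc.prems by auto
    then have "nat (int j + d) \<in> ?L" "int (nat (int j + d)) - int j = d" using d by auto
    then show "d \<in> (\<lambda>l. int l - int j) ` ?L" by (metis (no_types, lifting) imageI)
  qed auto
  finally show ?case by simp
qed

lemma toeplitz_pow_row_sum:
  "i < n \<Longrightarrow> (\<Sum>j<n. cmod ((toeplitz a m n ^\<^sub>m k) $$ (i, j))) \<le> symbol_norm ^ k"
proof (induction k)
  case 0
  have "(\<Sum>j<n. cmod ((toeplitz a m n ^\<^sub>m 0) $$ (i, j))) = (\<Sum>j<n. if j = i then 1 else 0)"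
    using 0 carrier_matD[OF toeplitz_carrier[of n]] by (intro sum.cong) auto
  then show ?case using 0 by simp
next
  case (Suc k)
  let ?T = "\<lambda>l. cmod ((toeplitz a m n ^\<^sub>m k) $$ (i, l))"
  have S: "0 \<le> symbol_norm" by (auto simp: symbol_norm_def intro: sum_nonneg)
  have "(\<Sum>j<n. cmod ((toeplitz a m n ^\<^sub>m Suc k) $$ (i, j))) \<le> (\<Sum>j<n. \<Sum>l<n. ?T l * cmod (entry l j))"
    using Suc.prems by (intro sum_mono) (auto simp: toeplitz_pow_Suc norm_mult simp del: pow_mat.simps intro!: sum_norm_le)
  also have "\<dots> = (\<Sum>l<n. ?T l * (\<Sum>j<n. cmod (entry l j)))"
    by (subst sum.swap) (simp add: sum_distrib_left)
  also have "\<dots> \<le> (\<Sum>l<n. ?T l * symbol_norm)"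
    by (intro sum_mono mult_left_mono entry_row_sum) auto
  also have "\<dots> \<le> symbol_norm ^ k * symbol_norm"
    unfolding sum_distrib_right[symmetric] using Suc S by (intro mult_right_mono) auto
  finally show ?case by (simp add: mult.commute)
qed

text \<open>
  Only the \<open>2 * k * m\<close> diagonal entries near the two corners differ from
  \<open>power_coeff k 0\<close>, and each of them is bounded independently of \<open>n\<close>.
\<close>

lemma trace_power_bound:
  "cmod (mat_trace (toeplitz a m n ^\<^sub>m k) - of_nat n * power_coeff k 0)
     \<le> real (2 * (k * m)) * (symbol_norm ^ k + cmod (power_coeff k 0))"
proof -
  let ?T = "toeplitz a m n ^\<^sub>m k"
  let ?bad = "{i. i < n \<and> (i < k * m \<or> n \<le> i + k * m)}"
  have "mat_trace ?T - of_nat n * power_coeff k 0 = (\<Sum>i<n. ?T $$ (i, i) - power_coeff k 0)"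
    using carrier_matD[OF toeplitz_pow_carrier[of n k]] by (simp add: mat_trace_def sum_subtractf)
  also have "\<dots> = (\<Sum>i\<in>?bad. ?T $$ (i, i) - power_coeff k 0)"
  proof (rule sum.mono_neutral_right)
    show "\<forall>i\<in>{..<n} - ?bad. ?T $$ (i, i) - power_coeff k 0 = 0"
    proof
      fix i assume "i \<in> {..<n} - ?bad"
      then have "i < n" "k * m \<le> i" "i + k * m < n" by auto
      from toeplitz_pow_interior[OF this] show "?T $$ (i, i) - power_coeff k 0 = 0" by simp
    qed
  qed auto
  finally have "cmod (mat_trace ?T - of_nat n * power_coeff k 0) = cmod (\<Sum>i\<in>?bad. ?T $$ (i, i) - power_coeff k 0)"
    by (rule arg_cong)
  also have "\<dots> \<le> (\<Sum>i\<in>?bad. symbol_norm ^ k + cmod (power_coeff k 0))"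
  proof (rule sum_norm_le)
    fix i assume "i \<in> ?bad"
    then have i: "i < n" by simp
    have "cmod (?T $$ (i, i)) \<le> (\<Sum>j<n. cmod (?T $$ (i, j)))"
      using i by (intro member_le_sum) auto
    also have "\<dots> \<le> symbol_norm ^ k" using i by (rule toeplitz_pow_row_sum)
    finally show "cmod (?T $$ (i, i) - power_coeff k 0) \<le> symbol_norm ^ k + cmod (power_coeff k 0)"
      by (intro order_trans[OF norm_triangle_ineq4] add_right_mono)
  qed
  also have "\<dots> = real (card ?bad) * (symbol_norm ^ k + cmod (power_coeff k 0))"
    by simp
  also have "\<dots> \<le> real (2 * (k * m)) * (symbol_norm ^ k + cmod (power_coeff k 0))"
  proof (intro mult_right_mono)
    have "card ?bad \<le> card ({..<k * m} \<union> {n - k * m..<n})"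
      by (intro card_mono) auto
    also have "\<dots> \<le> card {..<k * m} + card {n - k * m..<n}"
      by (rule card_Un_le)
    also have "\<dots> \<le> 2 * (k * m)" by simp
    finally show "real (card ?bad) \<le> real (2 * (k * m))" by (rule of_nat_mono)
    show "0 \<le> symbol_norm ^ k + cmod (power_coeff k 0)"
      by (auto simp: symbol_norm_def intro!: add_nonneg_nonneg zero_le_power sum_nonneg)
  qed
  finally show ?thesis .
qed

lemma trace_power_mean:
  "(\<lambda>n. mat_trace (toeplitz a m n ^\<^sub>m k) / of_nat n) \<longlonglongrightarrow> power_coeff k 0"
proof -
  define C where "C = real (2 * (k * m)) * (symbol_norm ^ k + cmod (power_coeff k 0))"
  have "(\<lambda>n. mat_trace (toeplitz a m n ^\<^sub>m k) / of_nat n - power_coeff k 0) \<longlonglongrightarrow> 0"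
  proof (rule Lim_null_comparison)
    show "eventually (\<lambda>n. cmod (mat_trace (toeplitz a m n ^\<^sub>m k) / of_nat n - power_coeff k 0) \<le> C / real n)
        sequentially"
      using eventually_gt_at_top[of 0]
    proof eventually_elim
      case (elim n)
      have "mat_trace (toeplitz a m n ^\<^sub>m k) / of_nat n - power_coeff k 0
          = (mat_trace (toeplitz a m n ^\<^sub>m k) - of_nat n * power_coeff k 0) / of_nat n"
        using elim by (simp add: field_simps)
      then show ?case
        using trace_power_bound[of n k] by (simp add: norm_divide C_def divide_right_mono)
    qed
    show "(\<lambda>n. C / real n) \<longlonglongrightarrow> 0" by (rule lim_const_over_n)
  qed
  then show ?thesis by (rule LIM_zero_cancel)
qed

text \<open>
  The linear functional on polynomials \<open>h\<close> given by the constant coefficient of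
  \<open>h\<close> applied to the symbol; it is the limit of the averages of \<open>h\<close>
  over the eigenvalues.
\<close>

definition symbol_mean :: "complex poly \<Rightarrow> complex" where
  "symbol_mean h = (\<Sum>k\<le>degree h. coeff h k * power_coeff k 0)"

lemma eigenvalue_mean:
  assumes "\<And>n k. mat_trace (toeplitz a m n ^\<^sub>m k) = (\<Sum>e\<leftarrow>es n. e ^ k)"
  shows "(\<lambda>n. (\<Sum>e\<leftarrow>es n. poly h e) / of_nat n) \<longlonglongrightarrow> symbol_mean h"
proof -
  have "(\<Sum>e\<leftarrow>es n. poly h e) = (\<Sum>k\<le>degree h. coeff h k * mat_trace (toeplitz a m n ^\<^sub>m k))" for n
    unfolding assms poly_altdef by (simp add: sum_list_sum_nth sum_distrib_left sum.swap[of _ "{..degree h}"])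
  then have "(\<Sum>e\<leftarrow>es n. poly h e) / of_nat n
      = (\<Sum>k\<le>degree h. coeff h k * (mat_trace (toeplitz a m n ^\<^sub>m k) / of_nat n))" for n
    by (simp add: sum_divide_distrib)
  then show ?thesis
    unfolding symbol_mean_def by (simp only:) (intro tendsto_sum tendsto_mult tendsto_const trace_power_mean)
qed

end

locale polar_symbol = laurent_symbol +
  fixes r :: "real \<Rightarrow> real"
  assumes C1: "C1_polar_radius r"
begin

definition curve :: "real \<Rightarrow> complex" where "curve \<theta> = complex_of_real (r \<theta>) * cis \<theta>"

lemma r_pos: "\<theta> \<in> {-pi..pi} \<Longrightarrow> 0 < r \<theta>"
  using C1 by (auto simp: C1_polar_radius_def)

lemma r_even: "\<theta> \<in> {-pi..pi} \<Longrightarrow> r (- \<theta>) = r \<theta>"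
  using C1 by (auto simp: C1_polar_radius_def)

lemma continuous_on_r: "continuous_on {-pi..pi} r"
proof -
  obtain r' where "\<forall>\<theta>\<in>{-pi..pi}. (r has_real_derivative r' \<theta>) (at \<theta> within {-pi..pi})"
    using C1 unfolding C1_polar_radius_def by blast
  then show ?thesis by (metis DERIV_continuous_on)
qed

lemma curve_nonzero: "\<theta> \<in> {-pi..pi} \<Longrightarrow> curve \<theta> \<noteq> 0"
  using r_pos[of \<theta>] by (auto simp: curve_def)

lemma continuous_on_curve: "continuous_on {-pi..pi} curve"
  unfolding curve_def by (intro continuous_intros continuous_on_r)

lemma continuous_on_f_curve: "continuous_on {-pi..pi} (\<lambda>\<theta>. f (curve \<theta>))"
  by (intro continuous_intros continuous_on_curve curve_nonzero)

text \<open>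
  Here \<open>\<rho> \<theta> + \<i>\<close> is the logarithmic derivative of the curve, so the
  integrals are contour integrals against \<open>dz / z\<close>. With the global logarithm
  \<open>E\<close> of the curve, the power \<open>z ^ (- d)\<close> with \<open>d \<noteq>
  0\<close> has the primitive \<open>exp (- d * E) / (- d)\<close>, which takes equal values at
  both ends; only the constant term contributes, with the increment \<open>2 * pi * \<i>\<close>
  of \<open>E\<close>.
\<close>

lemma curve_integral:
  obtains \<rho> where "\<And>h. ((\<lambda>\<theta>. poly h (f (curve \<theta>)) * (complex_of_real (\<rho> \<theta>) + \<i>))
     has_integral (2 * pi * \<i> * symbol_mean h)) {-pi..pi}"
proof -
  obtain r' where r': "\<And>\<theta>. \<theta> \<in> {-pi..pi} \<Longrightarrow> (r has_real_derivative r' \<theta>) (at \<theta> within {-pi..pi})"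
    using C1 unfolding C1_polar_radius_def by blast
  define \<rho> where "\<rho> = (\<lambda>\<theta>. r' \<theta> / r \<theta>)"
  define E where "E = (\<lambda>\<theta>. complex_of_real (ln (r \<theta>)) + \<i> * complex_of_real \<theta>)"
  define E' where "E' = (\<lambda>\<theta>. complex_of_real (\<rho> \<theta>) + \<i>)"
  have curve_E: "curve \<theta> = exp (E \<theta>)" if "\<theta> \<in> {-pi..pi}" for \<theta>
    using r_pos[OF that] by (simp add: curve_def E_def exp_add cis_conv_exp exp_of_real)
  have E': "(E has_vector_derivative E' \<theta>) (at \<theta> within {-pi..pi})" if "\<theta> \<in> {-pi..pi}" for \<theta>
  proof -
    have "((\<lambda>\<theta>. ln (r \<theta>)) has_real_derivative \<rho> \<theta>) (at \<theta> within {-pi..pi})"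
      unfolding \<rho>_def using r'[OF that] r_pos[OF that] by (auto intro!: derivative_eq_intros simp: field_simps)
    then have "((\<lambda>\<theta>. complex_of_real (ln (r \<theta>))) has_vector_derivative complex_of_real (\<rho> \<theta>)) (at \<theta> within {-pi..pi})"
      by (intro has_vector_derivative_of_real) (simp add: has_real_derivative_iff_has_vector_derivative)
    moreover have "((\<lambda>\<theta>. \<i> * complex_of_real \<theta>) has_vector_derivative \<i> * 1) (at \<theta> within {-pi..pi})"
      by (intro has_vector_derivative_mult_right) (auto intro!: derivative_eq_intros)
    ultimately show ?thesis
      unfolding E_def E'_def by (auto intro: has_vector_derivative_add)
  qed
  have E_ends: "E pi = E (- pi) + 2 * of_real pi * \<i>"
    using r_even[of pi] by (simp add: E_def algebra_simps)
  have mono: "((\<lambda>\<theta>. curve \<theta> powi (- d) * E' \<theta>) has_integral (if d = 0 then 2 * pi * \<i> else 0)) {-pi..pi}" for d :: int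
  proof (cases "d = 0")
    case True
    have "(E' has_integral (E pi - E (- pi))) {-pi..pi}"
      using E' by (intro fundamental_theorem_of_calculus) auto
    then show ?thesis using True E_ends by simp
  next
    case False
    define c where "c = complex_of_int (- d)"
    have c: "c \<noteq> 0" using False by (simp add: c_def)
    have "((\<lambda>\<theta>. exp (c * E \<theta>) / c) has_vector_derivative exp (c * E \<theta>) * E' \<theta>) (at \<theta> within {-pi..pi})"
      if "\<theta> \<in> {-pi..pi}" for \<theta>
    proof -
      have "((\<lambda>x. exp (c * x) / c) has_field_derivative exp (c * E \<theta>)) (at (E \<theta>))"
        using c by (auto intro!: derivative_eq_intros)
      from field_vector_diff_chain_within[OF E'[OF that] DERIV_subset[OF this subset_UNIV]]
      show ?thesis by (simp add: o_def mult.commute)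
    qed
    then have "((\<lambda>\<theta>. exp (c * E \<theta>) * E' \<theta>) has_integral (exp (c * E pi) / c - exp (c * E (- pi)) / c)) {-pi..pi}"
      by (intro fundamental_theorem_of_calculus) auto
    moreover have "exp (c * E pi) = exp (c * E (- pi))"
    proof -
      have "c * E pi = c * E (- pi) + of_int (2 * (- d)) * (of_real pi * \<i>)"
        unfolding E_ends c_def by (simp add: algebra_simps)
      then show ?thesis by (intro exp_eq[THEN iffD2] exI[of _ "- d"]) (simp add: mult_ac)
    qed
    ultimately have zero: "((\<lambda>\<theta>. exp (c * E \<theta>) * E' \<theta>) has_integral 0) {-pi..pi}"
      by simp
    have "exp (c * E \<theta>) * E' \<theta> = curve \<theta> powi (- d) * E' \<theta>" if "\<theta> \<in> {-pi..pi}" for \<theta>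
      unfolding curve_E[OF that] exp_power_int c_def ..
    from has_integral_eq[OF this zero] show ?thesis using False by simp
  qed
  have pow: "((\<lambda>\<theta>. f (curve \<theta>) ^ k * E' \<theta>) has_integral (2 * pi * \<i> * power_coeff k 0)) {-pi..pi}" for k
  proof -
    let ?I = "{- int (k * m)..int (k * m)}"
    have "((\<lambda>\<theta>. \<Sum>d\<in>?I. power_coeff k d * (curve \<theta> powi (- d) * E' \<theta>)) has_integral
        (\<Sum>d\<in>?I. power_coeff k d * (if d = 0 then 2 * pi * \<i> else 0))) {-pi..pi}"
      by (intro has_integral_sum has_integral_mult_right mono) auto
    moreover have "(\<Sum>d\<in>?I. power_coeff k d * (if d = 0 then 2 * pi * \<i> else 0)) = 2 * pi * \<i> * power_coeff k 0"
      by (simp add: if_distrib[of "(*) _"] sum.delta cong: if_cong)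
    moreover have "(\<Sum>d\<in>?I. power_coeff k d * (curve \<theta> powi (- d) * E' \<theta>)) = f (curve \<theta>) ^ k * E' \<theta>"
      if "\<theta> \<in> {-pi..pi}" for \<theta>
      unfolding f_power[OF curve_nonzero[OF that]] sum_distrib_right by (simp only: mult.assoc)
    ultimately show ?thesis
      using has_integral_eq[of "{-pi..pi}" "\<lambda>\<theta>. \<Sum>d\<in>?I. power_coeff k d * (curve \<theta> powi (- d) * E' \<theta>)"]
      by auto
  qed
  show thesis
  proof
    fix h :: "complex poly"
    have "((\<lambda>\<theta>. \<Sum>k\<le>degree h. coeff h k * (f (curve \<theta>) ^ k * E' \<theta>)) has_integral
        (\<Sum>k\<le>degree h. coeff h k * (2 * pi * \<i> * power_coeff k 0))) {-pi..pi}"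
      by (intro has_integral_sum has_integral_mult_right pow) auto
    then show "((\<lambda>\<theta>. poly h (f (curve \<theta>)) * (complex_of_real (\<rho> \<theta>) + \<i>))
        has_integral (2 * pi * \<i> * symbol_mean h)) {-pi..pi}"
      unfolding poly_altdef symbol_mean_def E'_def sum_distrib_left sum_distrib_right
      by (simp add: mult_ac)
  qed
qed


text \<open>
  For real integrands the radial part \<open>\<rho>\<close> of the logarithmic derivative drops
  out on taking imaginary parts, and what remains is integration against the positive measure
  \<open>d\<theta>\<close>.
\<close>

lemma real_curve_integral:
  assumes real: "\<And>\<theta>. \<theta> \<in> {-pi..pi} \<Longrightarrow> f (curve \<theta>) \<in> \<real>"
    and h: "\<And>x. x \<in> \<real> \<Longrightarrow> poly h x \<in> \<real>"
  shows "((\<lambda>\<theta>. Re (poly h (f (curve \<theta>)))) has_integral (2 * pi * Re (symbol_mean h))) {-pi..pi}"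
proof -
  obtain \<rho> where "((\<lambda>\<theta>. poly h (f (curve \<theta>)) * (complex_of_real (\<rho> \<theta>) + \<i>))
     has_integral (2 * pi * \<i> * symbol_mean h)) {-pi..pi}"
    using curve_integral by metis
  from has_integral_linear[OF this bounded_linear_Im]
  have int: "((\<lambda>\<theta>. Im (poly h (f (curve \<theta>)) * (complex_of_real (\<rho> \<theta>) + \<i>)))
     has_integral (2 * pi * Re (symbol_mean h))) {-pi..pi}"
    by (simp add: o_def)
  have "Im (poly h (f (curve \<theta>)) * (complex_of_real (\<rho> \<theta>) + \<i>)) = Re (poly h (f (curve \<theta>)))"
    if "\<theta> \<in> {-pi..pi}" for \<theta>
    using h[OF real[OF that]] by (simp add: complex_is_Real_iff)
  from has_integral_eq[OF this int] show ?thesis .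
qed

text \<open>
  Suppose infinitely many spectra avoid the disc of radius \<open>\<epsilon>\<close> around
  \<open>x0 = f (curve \<theta>0)\<close>. The parabola \<open>b x = C ^ 2 - (x - x0) ^
  2\<close> is nonnegative on the curve values, has modulus at most \<open>q1\<close> at all
  eigenvalues of these matrices and is at least \<open>q2 > q1\<close> near \<open>x0\<close>.
  Hence the mean of \<open>b ^ k\<close> is at most \<open>q1 ^ k\<close> and at least a
  positive constant times \<open>q2 ^ k\<close>, which is absurd for large \<open>k\<close>.
\<close>

lemma eigenvalues_near_curve_value:
  assumes real: "\<And>\<theta>. \<theta> \<in> {-pi..pi} \<Longrightarrow> f (curve \<theta>) \<in> \<real>"
    and near: "\<And>\<delta>. \<delta> > 0 \<Longrightarrow> eventually (\<lambda>n. \<forall>e\<in>spectrum (toeplitz a m n).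
                 \<exists>\<theta>\<in>{-pi..pi}. dist e (f (curve \<theta>)) < \<delta>) sequentially"
    and \<theta>0: "\<theta>0 \<in> {-pi..pi}" and \<epsilon>: "0 < \<epsilon>"
  shows "eventually (\<lambda>n. \<exists>e\<in>spectrum (toeplitz a m n). dist e (f (curve \<theta>0)) < \<epsilon>) sequentially"
proof (rule ccontr)
  assume "\<not> ?thesis"
  then have freq: "frequently (\<lambda>n. \<forall>e\<in>spectrum (toeplitz a m n). \<epsilon> \<le> dist e (f (curve \<theta>0))) sequentially"
    by (simp add: not_eventually not_less)
  define F where "F = (\<lambda>\<theta>. Re (f (curve \<theta>)))"
  have F: "f (curve \<theta>) = of_real (F \<theta>)" if "\<theta> \<in> {-pi..pi}" for \<theta>
    using real[OF that] by (simp add: F_def)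
  have contF: "continuous_on {-pi..pi} F"
    unfolding F_def by (intro continuous_intros continuous_on_f_curve)
  define x0 where "x0 = F \<theta>0"
  obtain B where B: "\<And>\<theta>. \<theta> \<in> {-pi..pi} \<Longrightarrow> \<bar>F \<theta>\<bar> \<le> B"
    using compact_imp_bounded[OF compact_continuous_image[OF contF compact_Icc]]
    unfolding bounded_iff by (metis imageI real_norm_def)
  (* bounds the distance of the curve values from x0; at least \<epsilon> to keep q1 positive *)
  define C where "C = max \<epsilon> (2 * B)"
  have C: "\<bar>F \<theta> - x0\<bar> \<le> C" if "\<theta> \<in> {-pi..pi}" for \<theta>
    using B[OF that] B[OF \<theta>0] by (auto simp: C_def x0_def)
  have C\<epsilon>: "\<epsilon> \<le> C" "0 < C" using \<epsilon> by (auto simp: C_def)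
  (* replacing an eigenvalue by a curve value within \<delta> then costs \<epsilon>^2 / 2 in the bound for b *)
  define \<delta> where "\<delta> = \<epsilon>\<^sup>2 / (4 * (\<epsilon> + C))"
  have \<delta>: "0 < \<delta>" "2 * \<delta> * (\<epsilon> + C) = \<epsilon>\<^sup>2 / 2"
    using \<epsilon> C\<epsilon> by (auto simp: \<delta>_def field_simps power2_eq_square)
  have \<delta>\<epsilon>: "\<delta> < \<epsilon>"
  proof -
    have "\<delta> * (4 * (\<epsilon> + C)) = \<epsilon> * \<epsilon>" using \<epsilon> C\<epsilon> by (simp add: \<delta>_def power2_eq_square)
    also have "\<dots> < \<epsilon> * (4 * (\<epsilon> + C))" using \<epsilon> C\<epsilon> by (intro mult_strict_left_mono) auto
    finally show ?thesis using \<epsilon> C\<epsilon> by (simp add: mult_less_cancel_right)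
  qed
  define q1 where "q1 = C\<^sup>2 - \<epsilon>\<^sup>2 / 2"
  define q2 where "q2 = C\<^sup>2 - \<epsilon>\<^sup>2 / 16"
  have "\<epsilon>\<^sup>2 \<le> C\<^sup>2" using C\<epsilon> \<epsilon> by (intro power_mono) auto
  moreover have "0 < \<epsilon>\<^sup>2" using \<epsilon> by simp
  ultimately have q: "0 < q1" "q1 < q2" unfolding q1_def q2_def by linarith+
  define b :: "complex poly" where "b = [:of_real (C\<^sup>2):] - [:- of_real x0, 1:] ^ 2"
  have b: "poly b x = of_real (C\<^sup>2) - (x - of_real x0)\<^sup>2" for x
    by (simp add: b_def)
  have b_real: "poly b (of_real x) = of_real (C\<^sup>2 - (x - x0)\<^sup>2)" for x
    by (simp add: b)
  have b_F: "0 \<le> C\<^sup>2 - (F \<theta> - x0)\<^sup>2" if "\<theta> \<in> {-pi..pi}" for \<theta>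
    using C[OF that] by (simp add: abs_le_square_iff[symmetric] C\<epsilon> less_imp_le)
  have b_small: "cmod (poly b e) \<le> q1"
    if \<theta>: "\<theta> \<in> {-pi..pi}" and e: "dist e (f (curve \<theta>)) < \<delta>" and far: "\<epsilon> \<le> dist e (f (curve \<theta>0))" for e \<theta>
  proof -
    let ?x = "F \<theta>"
    have d: "cmod (e - of_real ?x) < \<delta>" using e F[OF \<theta>] by (simp add: dist_norm)
    have "\<epsilon> \<le> cmod (e - of_real x0)" using far F[OF \<theta>0] by (simp add: dist_norm x0_def)
    also have "\<dots> \<le> cmod (e - of_real ?x) + cmod (of_real ?x - of_real x0)"
      using norm_triangle_ineq[of "e - of_real ?x" "of_real ?x - of_real x0"] by simp
    also have "cmod (of_real ?x - of_real x0) = \<bar>?x - x0\<bar>"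
      by (metis norm_of_real of_real_diff)
    finally have sep: "\<epsilon> - \<delta> \<le> \<bar>?x - x0\<bar>" using d by linarith
    have "(\<epsilon> - \<delta>)\<^sup>2 \<le> \<bar>?x - x0\<bar>\<^sup>2"
      using sep \<delta>\<epsilon> by (intro power_mono) auto
    then have sep2: "(\<epsilon> - \<delta>)\<^sup>2 \<le> (?x - x0)\<^sup>2" by simp
    have "poly b e = poly b (of_real ?x) - (e - of_real ?x) * ((e - of_real ?x) + 2 * of_real (?x - x0))"
      unfolding b by (simp add: algebra_simps power2_eq_square)
    then have "cmod (poly b e) \<le> cmod (poly b (of_real ?x))
        + cmod (e - of_real ?x) * cmod ((e - of_real ?x) + 2 * of_real (?x - x0))"
      by (metis norm_mult norm_triangle_ineq4)
    also have "\<dots> \<le> (C\<^sup>2 - (?x - x0)\<^sup>2) + \<delta> * (\<delta> + 2 * C)"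
    proof (intro add_mono mult_mono)
      show "cmod (poly b (of_real ?x)) \<le> C\<^sup>2 - (?x - x0)\<^sup>2"
        unfolding b_real norm_of_real using b_F[OF \<theta>] by simp
      have "cmod ((e - of_real ?x) + 2 * of_real (?x - x0)) \<le> cmod (e - of_real ?x) + cmod (2 * of_real (?x - x0))"
        by (rule norm_triangle_ineq)
      also have "cmod (2 * of_real (?x - x0)) = 2 * \<bar>?x - x0\<bar>"
        unfolding norm_mult norm_of_real by simp
      also have "cmod (e - of_real ?x) + 2 * \<bar>?x - x0\<bar> \<le> \<delta> + 2 * C"
        by (intro add_mono) (use d C[OF \<theta>] in auto)
      finally show "cmod ((e - of_real ?x) + 2 * of_real (?x - x0)) \<le> \<delta> + 2 * C" .
    qed (use d \<delta> in auto)
    also have "\<dots> \<le> C\<^sup>2 - (\<epsilon> - \<delta>)\<^sup>2 + \<delta> * (\<delta> + 2 * C)"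
      using sep2 by simp
    also have "\<dots> = C\<^sup>2 - \<epsilon>\<^sup>2 + 2 * \<delta> * (\<epsilon> + C)"
      by (simp add: algebra_simps power2_eq_square)
    also have "\<dots> = q1" unfolding \<delta>(2) q1_def by simp
    finally show ?thesis .
  qed

  have "\<exists>es. length es = n \<and> set es = spectrum (toeplitz a m n) \<and>
          (\<forall>k. mat_trace (toeplitz a m n ^\<^sub>m k) = (\<Sum>e\<leftarrow>es. e ^ k))" for n
    using trace_power_eigenvalues[OF toeplitz_carrier[of n]] by metis
  then obtain es where es: "\<And>n. length (es n) = n" "\<And>n. set (es n) = spectrum (toeplitz a m n)"
      "\<And>n k. mat_trace (toeplitz a m n ^\<^sub>m k) = (\<Sum>e\<leftarrow>es n. e ^ k)"
    by metis

  have upper: "cmod (symbol_mean (b ^ k)) \<le> q1 ^ k" for k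
  proof (rule ccontr)
    assume "\<not> ?thesis"
    then have "q1 ^ k < cmod (symbol_mean (b ^ k))" by simp
    moreover have "(\<lambda>n. cmod ((\<Sum>e\<leftarrow>es n. poly (b ^ k) e) / of_nat n)) \<longlonglongrightarrow> cmod (symbol_mean (b ^ k))"
      by (intro tendsto_norm eigenvalue_mean es)
    ultimately have "eventually (\<lambda>n. q1 ^ k < cmod ((\<Sum>e\<leftarrow>es n. poly (b ^ k) e) / of_nat n)) sequentially"
      by (rule order_tendstoD[rotated])
    with near[OF \<delta>(1)] have "eventually (\<lambda>n. q1 ^ k < cmod ((\<Sum>e\<leftarrow>es n. poly (b ^ k) e) / of_nat n) \<and>
        (\<forall>e\<in>spectrum (toeplitz a m n). \<exists>\<theta>\<in>{-pi..pi}. dist e (f (curve \<theta>)) < \<delta>)) sequentially"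
      by eventually_elim auto
    from frequently_ex[OF frequently_eventually_frequently[OF freq this]]
    obtain n where n: "\<And>e. e \<in> spectrum (toeplitz a m n) \<Longrightarrow> \<epsilon> \<le> dist e (f (curve \<theta>0))"
      "q1 ^ k < cmod ((\<Sum>e\<leftarrow>es n. poly (b ^ k) e) / of_nat n)"
      "\<And>e. e \<in> spectrum (toeplitz a m n) \<Longrightarrow> \<exists>\<theta>\<in>{-pi..pi}. dist e (f (curve \<theta>)) < \<delta>"
      by blast
    have "cmod (\<Sum>e\<leftarrow>es n. poly (b ^ k) e) \<le> (\<Sum>e\<leftarrow>es n. cmod (poly (b ^ k) e))"
    proof -
      have "cmod (\<Sum>e\<leftarrow>xs. g e) \<le> (\<Sum>e\<leftarrow>xs. cmod (g e))" for xs and g :: "complex \<Rightarrow> complex"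
        by (induction xs) (auto intro: order_trans[OF norm_triangle_ineq])
      then show ?thesis .
    qed
    also have "\<dots> \<le> (\<Sum>e\<leftarrow>es n. q1 ^ k)"
    proof (rule sum_list_mono)
      fix e assume "e \<in> set (es n)"
      then have e: "e \<in> spectrum (toeplitz a m n)" by (simp add: es(2))
      obtain \<theta> where "\<theta> \<in> {-pi..pi}" "dist e (f (curve \<theta>)) < \<delta>"
        using n(3)[OF e] by blast
      then have "cmod (poly b e) \<le> q1" using n(1)[OF e] by (rule b_small)
      then show "cmod (poly (b ^ k) e) \<le> q1 ^ k"
        by (simp add: norm_power power_mono)
    qed
    also have "\<dots> = real n * q1 ^ k" by (simp add: sum_list_triv es(1))
    finally have *: "cmod (\<Sum>e\<leftarrow>es n. poly (b ^ k) e) \<le> real n * q1 ^ k" .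
    have "n > 0" using n(2) q by (cases n) auto
    then have "cmod ((\<Sum>e\<leftarrow>es n. poly (b ^ k) e) / of_nat n) \<le> q1 ^ k"
      using * by (simp add: norm_divide field_simps)
    then show False using n(2) by simp
  qed

  obtain d where d: "0 < d" "\<And>\<theta>. \<theta> \<in> {-pi..pi} \<Longrightarrow> dist \<theta> \<theta>0 < d \<Longrightarrow> dist (F \<theta>) (F \<theta>0) < \<epsilon> / 4"
    using contF \<theta>0 \<epsilon> unfolding continuous_on_iff by (metis divide_pos_pos zero_less_numeral)
  define \<alpha> where "\<alpha> = max (- pi) (\<theta>0 - d / 2)"
  define \<gamma> where "\<gamma> = min pi (\<theta>0 + d / 2)"
  have \<alpha>\<gamma>: "\<alpha> < \<gamma>" "{\<alpha>..\<gamma>} \<subseteq> {-pi..pi}"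
    using \<theta>0 d(1) by (auto simp: \<alpha>_def \<gamma>_def)
  have lower: "(\<gamma> - \<alpha>) * q2 ^ k \<le> 2 * pi * Re (symbol_mean (b ^ k))" for k
  proof -
    let ?g = "\<lambda>\<theta>. Re (poly (b ^ k) (f (curve \<theta>)))"
    have g: "?g \<theta> = (C\<^sup>2 - (F \<theta> - x0)\<^sup>2) ^ k" if "\<theta> \<in> {-pi..pi}" for \<theta>
      unfolding F[OF that] poly_power b_real by (metis Re_complex_of_real of_real_power)
    have int: "(?g has_integral (2 * pi * Re (symbol_mean (b ^ k)))) {-pi..pi}"
    proof (rule real_curve_integral)
      fix x :: complex assume "x \<in> \<real>"
      then obtain y where "x = of_real y" by (auto elim: Reals_cases)
      then show "poly (b ^ k) x \<in> \<real>" by (simp add: b_real del: of_real_diff of_real_power)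
    qed (use real in auto)
    have int2: "((\<lambda>_. q2 ^ k) has_integral (q2 ^ k * (\<gamma> - \<alpha>))) {\<alpha>..\<gamma>}"
      using has_integral_const_real[of "q2 ^ k" \<alpha> \<gamma>] \<alpha>\<gamma> by (simp add: mult.commute)
    have intsub: "?g integrable_on {\<alpha>..\<gamma>}"
      using has_integral_integrable[OF int] \<alpha>\<gamma>(2) by (rule integrable_on_subinterval)
    have "q2 ^ k * (\<gamma> - \<alpha>) \<le> integral {\<alpha>..\<gamma>} ?g"
    proof (rule has_integral_le[OF int2 integrable_integral[OF intsub]])
      fix \<theta> assume \<theta>: "\<theta> \<in> {\<alpha>..\<gamma>}"
      then have I: "\<theta> \<in> {-pi..pi}" using \<alpha>\<gamma>(2) by blast
      have "dist \<theta> \<theta>0 < d"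
        using \<theta> d(1) by (auto simp: \<alpha>_def \<gamma>_def dist_real_def abs_if field_simps)
      then have "\<bar>F \<theta> - x0\<bar> \<le> \<epsilon> / 4" using d(2)[OF I] by (simp add: dist_real_def x0_def)
      then have "\<bar>F \<theta> - x0\<bar>\<^sup>2 \<le> (\<epsilon> / 4)\<^sup>2" by (intro power_mono) auto
      then have "q2 \<le> C\<^sup>2 - (F \<theta> - x0)\<^sup>2" by (simp add: q2_def power_divide)
      then show "q2 ^ k \<le> ?g \<theta>" unfolding g[OF I] using q by (intro power_mono) auto
    qed
    also have "\<dots> \<le> integral {-pi..pi} ?g"
    proof (rule integral_subset_le[OF \<alpha>\<gamma>(2) intsub has_integral_integrable[OF int]])
      show "\<forall>\<theta>\<in>{-pi..pi}. 0 \<le> ?g \<theta>"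
      proof
        fix \<theta> assume I: "\<theta> \<in> {-pi..pi}"
        show "0 \<le> ?g \<theta>" unfolding g[OF I] using b_F[OF I] by simp
      qed
    qed
    also have "\<dots> = 2 * pi * Re (symbol_mean (b ^ k))"
      using int by (rule integral_unique)
    finally show ?thesis by (simp add: mult.commute)
  qed
  have ineq: "(\<gamma> - \<alpha>) \<le> 2 * pi * (q1 / q2) ^ k" for k
  proof -
    have "(\<gamma> - \<alpha>) * q2 ^ k \<le> 2 * pi * Re (symbol_mean (b ^ k))" by (rule lower)
    also have "\<dots> \<le> 2 * pi * q1 ^ k"
      using order_trans[OF complex_Re_le_cmod upper[of k]] by simp
    finally show ?thesis using q by (simp add: power_divide field_simps)
  qed
  have "(\<lambda>k. 2 * pi * (q1 / q2) ^ k) \<longlonglongrightarrow> 2 * pi * 0"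
    using q by (intro tendsto_intros LIMSEQ_power_zero) auto
  then have "\<gamma> - \<alpha> \<le> 2 * pi * 0"
    by (rule LIMSEQ_le_const) (use ineq in auto)
  then show False using \<alpha>\<gamma>(1) by simp
qed

end

section \<open>Roots inside and outside the polar curve\<close>

text \<open>
  Only one term of each sequence has to agree with the limit, which is what convergence of the
  roots along subsequences provides.
\<close>

lemma connected_sequentially_constant:
  fixes g :: "'a::metric_space \<Rightarrow> 'b"
  assumes "connected S"
    and seq: "\<And>x X. x \<in> S \<Longrightarrow> (\<And>n. X n \<in> S) \<Longrightarrow> X \<longlonglongrightarrow> x \<Longrightarrow> \<exists>n::nat. g (X n) = g x"
  shows "g constant_on S"
  using assms(1)
proof (rule locally_constant_imp_constant)
  fix x assume x: "x \<in> S"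
  have "\<exists>e>0. \<forall>y\<in>S \<inter> ball x e. g y = g x"
  proof (rule ccontr)
    assume "\<not> ?thesis"
    then have far: "\<exists>y\<in>S \<inter> ball x e. g y \<noteq> g x" if "e > 0" for e
      using that by blast
    have "\<exists>y. y \<in> S \<and> dist y x < inverse (real (Suc n)) \<and> g y \<noteq> g x" for n
    proof -
      have "0 < inverse (real (Suc n))" by simp
      from far[OF this] show ?thesis by (auto simp: dist_commute)
    qed
    then obtain X where X: "\<And>n. X n \<in> S" "\<And>n. dist (X n) x < inverse (real (Suc n))" "\<And>n. g (X n) \<noteq> g x"
      by metis
    have "(\<lambda>n. dist (X n) x) \<longlonglongrightarrow> 0"
    proof (rule tendsto_sandwich[OF _ _ tendsto_const LIMSEQ_inverse_real_of_nat])
      show "\<forall>\<^sub>F n in sequentially. dist (X n) x \<le> inverse (real (Suc n))"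
        by (intro always_eventually allI less_imp_le X)
    qed simp
    then have "X \<longlonglongrightarrow> x" by (rule iffD2[OF tendsto_dist_iff])
    then show False using seq[of x X] X x by blast
  qed
  then obtain e where "e > 0" "\<forall>y\<in>S \<inter> ball x e. g y = g x" by blast
  then show "\<exists>T. openin (top_of_set S) T \<and> x \<in> T \<and> (\<forall>y\<in>T. g y = g x)"
    using x by (intro exI[of _ "S \<inter> ball x e"] conjI openin_open_Int open_ball IntI centre_in_ball[THEN iffD2])
qed

lemma uniform_limit_finite_sum:
  fixes g :: "'i \<Rightarrow> 'a \<Rightarrow> 'b \<Rightarrow> 'c::real_normed_vector"
  assumes "finite I" "\<And>i. i \<in> I \<Longrightarrow> uniform_limit K (g i) (l i) F"
  shows "uniform_limit K (\<lambda>n x. \<Sum>i\<in>I. g i n x) (\<lambda>x. \<Sum>i\<in>I. l i x) F"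
  using assms by (induction I rule: finite_induct) (auto intro!: uniform_limit_add uniform_limit_const)

lemma tendsto_eventually_same_sign:
  fixes X :: "nat \<Rightarrow> real"
  assumes "X \<longlonglongrightarrow> x" "x \<noteq> 0"
  shows "eventually (\<lambda>n. (X n < 0 \<longleftrightarrow> x < 0) \<and> (0 < X n \<longleftrightarrow> 0 < x)) sequentially"
proof (cases "x < 0")
  case True
  from order_tendstoD(2)[OF assms(1) True] show ?thesis
    by eventually_elim (use True in auto)
next
  case False
  then have "0 < x" using assms(2) by simp
  from order_tendstoD(1)[OF assms(1) this] show ?thesis
    by eventually_elim (use \<open>0 < x\<close> in auto)
qed

context polar_symbol
begin

text \<open>
  The radius of the curve in the direction of \<open>w\<close>. As \<open>r\<close> is even, the
  angle may be replaced by its absolute value, and \<open>arccos (Re w / cmod w)\<close> is that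
  absolute value and is continuous across the negative axis, unlike \<open>Arg\<close>.
\<close>

definition radius :: "complex \<Rightarrow> real" where
  "radius w = r (arccos (Re w / cmod w))"

text \<open>
  Negative inside the curve, zero on it, positive outside.
\<close>

definition excess :: "complex \<Rightarrow> real" where
  "excess w = cmod w - radius w"

lemma Re_quotient: "w \<noteq> 0 \<Longrightarrow> Re w / cmod w \<in> {-1..1}"
  using abs_Re_le_cmod[of w] by (auto simp: field_simps abs_le_iff)

lemma arccos_range: "x \<in> {-1..1} \<Longrightarrow> arccos x \<in> {-pi..pi}"
  using arccos_bounded[of x] pi_ge_zero by (auto intro: order_trans[of "- pi" 0])

lemma continuous_on_excess: "continuous_on (- {0}) excess"
proof -
  have "continuous_on (- {0}) (\<lambda>w. Re w / cmod w)"
    by (intro continuous_intros) auto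
  then have "continuous_on (- {0}) (\<lambda>w. arccos (Re w / cmod w))"
    by (rule continuous_on_compose2[OF continuous_on_arccos']) (intro image_subsetI Re_quotient, simp)
  then have "continuous_on (- {0}) (\<lambda>w. r (arccos (Re w / cmod w)))"
    by (rule continuous_on_compose2[OF continuous_on_r])
       (intro image_subsetI arccos_range Re_quotient, simp)
  then show ?thesis
    unfolding excess_def radius_def by (intro continuous_intros)
qed

lemma tendsto_excess:
  assumes "(g \<longlongrightarrow> w) F" "w \<noteq> 0"
  shows "((\<lambda>n. excess (g n)) \<longlongrightarrow> excess w) F"
proof -
  have "isCont excess w"
    using continuous_on_excess assms(2) by (simp add: continuous_on_eq_continuous_at open_Compl)
  then show ?thesis using assms(1) by (rule isCont_tendsto_compose)
qed

lemma radius_polar: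
  assumes "0 < s" "\<theta> \<in> {-pi..pi}"
  shows "radius (complex_of_real s * cis \<theta>) = r \<theta>"
proof -
  have "Re (complex_of_real s * cis \<theta>) / cmod (complex_of_real s * cis \<theta>) = cos \<theta>"
    using assms by (simp add: norm_mult)
  moreover have "arccos (cos \<theta>) = \<bar>\<theta>\<bar>"
    using assms by (cases "0 \<le> \<theta>") (auto simp: arccos_cos arccos_cos2)
  ultimately show ?thesis
    using r_even[OF assms(2)] by (auto simp: radius_def abs_if)
qed

lemma excess_curve: "\<theta> \<in> {-pi..pi} \<Longrightarrow> excess (curve \<theta>) = 0"
  using radius_polar[OF r_pos, of \<theta> \<theta>] r_pos[of \<theta>] by (simp add: excess_def curve_def norm_mult)

lemma excess_eq_0E:
  assumes "excess w = 0" "w \<noteq> 0"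
  obtains \<theta> where "\<theta> \<in> {-pi..pi}" "w = curve \<theta>"
proof
  show I: "Arg w \<in> {-pi..pi}"
    using mpi_less_Arg[of w] Arg_le_pi[of w] by auto
  have w: "w = complex_of_real (cmod w) * cis (Arg w)"
    using rcis_cmod_Arg[of w] by (simp add: rcis_def)
  have "radius w = r (Arg w)"
    using radius_polar[OF _ I, of "cmod w"] w assms(2) by simp
  then show "w = curve (Arg w)"
    using w assms(1) by (simp add: curve_def excess_def)
qed

definition curve_values :: "complex set" where
  "curve_values = (\<lambda>\<theta>. f (curve \<theta>)) ` {-pi..pi}"

lemma excess_eq_0_imp_curve_value: "excess w = 0 \<Longrightarrow> w \<noteq> 0 \<Longrightarrow> f w \<in> curve_values"
  by (metis excess_eq_0E curve_values_def imageI)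

lemma compact_curve_values: "compact curve_values"
  unfolding curve_values_def by (intro compact_continuous_image continuous_on_f_curve) auto

lemma connected_curve_values: "connected curve_values"
  unfolding curve_values_def by (intro connected_continuous_image continuous_on_f_curve) auto

lemma radius_bounds:
  obtains \<theta>1 \<theta>2 where "\<theta>1 \<in> {-pi..pi}" "\<theta>2 \<in> {-pi..pi}"
    "\<And>w. w \<noteq> 0 \<Longrightarrow> r \<theta>1 \<le> radius w \<and> radius w \<le> r \<theta>2"
proof -
  have ne: "{-pi..pi} \<noteq> {}" by simp
  obtain \<theta>1 where 1: "\<theta>1 \<in> {-pi..pi}" "\<forall>t\<in>{-pi..pi}. r \<theta>1 \<le> r t"
    using continuous_attains_inf[OF compact_Icc ne continuous_on_r] by blast
  obtain \<theta>2 where 2: "\<theta>2 \<in> {-pi..pi}" "\<forall>t\<in>{-pi..pi}. r t \<le> r \<theta>2"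
    using continuous_attains_sup[OF compact_Icc ne continuous_on_r] by blast
  show thesis
    using that[OF 1(1) 2(1)] 1(2) 2(2) Re_quotient arccos_range unfolding radius_def by blast
qed

end

locale curve_symbol = sorted_symbol a m z + polar_symbol a m r
  for a m z r +
  assumes span: "middle_roots m z = polar_curve r" and sep: "separated m z"
begin

lemma polar_curve_eq: "polar_curve r = curve ` {-pi..pi}"
  by (simp add: polar_curve_def curve_def[abs_def])

lemma root_nonzero: "poly (P lam) w = 0 \<Longrightarrow> w \<noteq> 0"
  by (simp add: poly_P_eq_0_iff)

lemma m_index: "m \<in> {1..2*m}" "m + 1 \<in> {1..2*m}"
  using m_pos by auto

text \<open>
  Points of the curve are middle roots and middle roots lie on the curve, by the assumption on
  the span; and a middle root determines its parameter as the value of the symbol there.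
\<close>

lemma curve_value_props:
  assumes "lam \<in> curve_values"
  shows "lam \<in> \<real>" "cmod (z m lam) = cmod (z (m + 1) lam)"
    "excess (z m lam) = 0" "excess (z (m + 1) lam) = 0"
    "\<And>w. poly (P lam) w = 0 \<Longrightarrow> excess w = 0 \<Longrightarrow> w \<in> {z m lam, z (m + 1) lam}"
proof -
  have mid: "f w \<in> \<real> \<and> cmod (z m (f w)) = cmod (z (m + 1) (f w)) \<and> w \<in> {z m (f w), z (m + 1) (f w)}"
    if "w \<in> middle_roots m z" for w
  proof -
    from that obtain l where l: "l \<in> \<real>" "cmod (z m l) = cmod (z (m + 1) l)" "w \<in> {z m l, z (m + 1) l}"
      by (auto simp: middle_roots_def)
    have "poly (P l) w = 0" using l(3) root_z m_index by blast
    then have "f w = l" by (simp add: poly_P_eq_0_iff)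
    then show ?thesis using l by simp
  qed
  from assms obtain \<theta> where \<theta>: "\<theta> \<in> {-pi..pi}" "lam = f (curve \<theta>)"
    by (auto simp: curve_values_def)
  then have "curve \<theta> \<in> middle_roots m z"
    unfolding span polar_curve_eq by blast
  from mid[OF this] show real: "lam \<in> \<real>" and eq: "cmod (z m lam) = cmod (z (m + 1) lam)"
    using \<theta> by auto
  have "{z m lam, z (m + 1) lam} \<subseteq> middle_roots m z"
    using real eq by (auto simp: middle_roots_def)
  then show "excess (z m lam) = 0" "excess (z (m + 1) lam) = 0"
    unfolding span polar_curve_eq using excess_curve by auto
  fix w assume w: "poly (P lam) w = 0" "excess w = 0"
  then have "w \<in> middle_roots m z"
    unfolding span polar_curve_eq using excess_eq_0E root_nonzero by (metis imageI)
  from mid[OF this] show "w \<in> {z m lam, z (m + 1) lam}"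
    using w(1) by (simp add: poly_P_eq_0_iff)
qed

lemma curve_values_real: "curve_values \<subseteq> \<real>"
  using curve_value_props(1) by blast

lemma modulus_separated:
  assumes lam: "lam \<in> curve_values" and j: "j \<in> {1..2*m}"
  shows "j < m \<Longrightarrow> cmod (z j lam) < cmod (z m lam)"
    and "m + 1 < j \<Longrightarrow> cmod (z m lam) < cmod (z j lam)"
proof -
  note p = curve_value_props[OF lam]
  have *: "cmod (z (m - 1) lam) < cmod (z m lam)" "cmod (z (m + 1) lam) < cmod (z (m + 2) lam)" if "2 \<le> m"
    using sep p(1,2) that unfolding separated_def by blast+
  show "cmod (z j lam) < cmod (z m lam)" if "j < m"
  proof -
    have "cmod (z j lam) \<le> cmod (z (m - 1) lam)" using that j by (intro modulus_mono) auto
    then show ?thesis using * that j by force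
  qed
  show "cmod (z m lam) < cmod (z j lam)" if "m + 1 < j"
  proof -
    have "cmod (z (m + 2) lam) \<le> cmod (z j lam)" using that j by (intro modulus_mono) auto
    then show ?thesis using * p(2) that j by force
  qed
qed

text \<open>
  Stated for an arbitrary enumeration with the same moduli, since limits of sorted roots need
  not be the roots \<open>z j lam\<close> in the chosen order.
\<close>

lemma roots_by_modulus:
  assumes lam: "lam \<in> curve_values"
    and enum: "image_mset \<zeta> (mset_set {1..2 * m}) = proots (P lam)"
    and mod: "\<And>j. j \<in> {1..2*m} \<Longrightarrow> cmod (\<zeta> j) = cmod (z j lam)"
  shows "{w. poly (P lam) w = 0 \<and> cmod w < cmod (z m lam)} = \<zeta> ` {1..<m}"
    and "{w. poly (P lam) w = 0 \<and> cmod (z m lam) < cmod w} = \<zeta> ` {m+2..2*m}"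
    and "{w. poly (P lam) w = 0 \<and> cmod w = cmod (z m lam)} = \<zeta> ` {m, m + 1}"
proof -
  have set: "{w. poly (P lam) w = 0 \<and> Q (cmod w)} = \<zeta> ` {j\<in>{1..2*m}. Q (cmod (z j lam))}" for Q
  proof -
    have "{w. poly (P lam) w = 0 \<and> Q (cmod w)} = {w \<in> \<zeta> ` {1..2*m}. Q (cmod w)}"
      using enumeration_set[OF enum] by blast
    also have "\<dots> = \<zeta> ` {j\<in>{1..2*m}. Q (cmod (z j lam))}"
      using mod by auto
    finally show ?thesis .
  qed
  note s = modulus_separated[OF lam]
  note e = curve_value_props(2)[OF lam]
  have tri: "(cmod (z j lam) < cmod (z m lam) \<longleftrightarrow> j < m) \<and> (cmod (z m lam) < cmod (z j lam) \<longleftrightarrow> m + 1 < j)"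
    if "j \<in> {1..2*m}" for j
  proof -
    consider "j < m" | "j = m" | "j = m + 1" | "m + 1 < j" by linarith
    then show ?thesis
      using s[OF that] e by cases auto
  qed
  show "{w. poly (P lam) w = 0 \<and> cmod w < cmod (z m lam)} = \<zeta> ` {1..<m}"
    unfolding set[of "\<lambda>x. x < cmod (z m lam)"] using tri by (intro arg_cong[where f = "image \<zeta>"]) auto
  show "{w. poly (P lam) w = 0 \<and> cmod (z m lam) < cmod w} = \<zeta> ` {m+2..2*m}"
    unfolding set[of "\<lambda>x. cmod (z m lam) < x"] using tri by (intro arg_cong[where f = "image \<zeta>"]) auto
  have "{j \<in> {1..2*m}. cmod (z j lam) = cmod (z m lam)} = {m, m + 1}"
  proof (intro equalityI subsetI)
    fix j assume j: "j \<in> {j \<in> {1..2*m}. cmod (z j lam) = cmod (z m lam)}"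
    then have "\<not> j < m" "\<not> m + 1 < j" using tri[of j] by auto
    then show "j \<in> {m, m + 1}" by auto
  qed (use e m_index in auto)
  then show "{w. poly (P lam) w = 0 \<and> cmod w = cmod (z m lam)} = \<zeta> ` {m, m + 1}"
    unfolding set[of "\<lambda>x. x = cmod (z m lam)"] by (rule arg_cong)
qed

text \<open>
  For \<open>lam\<close> in \<open>curve_values\<close>, the roots other than the middle ones
  are off the curve. They move continuously with \<open>lam\<close>, and by separation they keep
  away from the middle modulus, so the side of the curve on which they lie is constant on the
  connected set \<open>curve_values\<close>. At the point of the curve nearest to the origin all
  roots of smaller modulus are inside, and at the farthest point all roots of larger modulus are
  outside.
\<close>

lemma side_of_roots_over_curve_values:
  assumes "lam \<in> curve_values" "poly (P lam) w = 0"
  shows "cmod w < cmod (z m lam) \<Longrightarrow> excess w < 0" "cmod (z m lam) < cmod w \<Longrightarrow> 0 < excess w"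
proof -
  define g where "g lam = ((\<forall>w\<in>{w. poly (P lam) w = 0 \<and> cmod w < cmod (z m lam)}. excess w < 0),
     (\<forall>w\<in>{w. poly (P lam) w = 0 \<and> cmod (z m lam) < cmod w}. 0 < excess w))" for lam
  have "g constant_on curve_values"
    using connected_curve_values
  proof (rule connected_sequentially_constant)
    fix lam X assume lam: "lam \<in> curve_values" and X: "\<And>n::nat. X n \<in> curve_values" "X \<longlonglongrightarrow> lam"
    obtain \<phi> \<zeta> where \<phi>: "strict_mono (\<phi> :: nat \<Rightarrow> nat)"
      and lim: "\<And>j. j \<in> {1..2*m} \<Longrightarrow> (\<lambda>n. z j (X (\<phi> n))) \<longlonglongrightarrow> \<zeta> j"
      and enum: "image_mset \<zeta> (mset_set {1..2 * m}) = proots (P lam)"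
      and mod: "\<And>j. j \<in> {1..2*m} \<Longrightarrow> cmod (\<zeta> j) = cmod (z j lam)"
      using roots_subsequence[OF X(2)] by metis
    have root: "poly (P lam) (\<zeta> j) = 0" if "j \<in> {1..2*m}" for j
      using enumeration_set[OF enum] that by blast
    have "eventually (\<lambda>n. (excess (z j (X (\<phi> n))) < 0 \<longleftrightarrow> excess (\<zeta> j) < 0) \<and>
        (0 < excess (z j (X (\<phi> n))) \<longleftrightarrow> 0 < excess (\<zeta> j))) sequentially" if "j \<in> {1..<m} \<union> {m+2..2*m}" for j
    proof (rule tendsto_eventually_same_sign)
      have j: "j \<in> {1..2*m}" using that by auto
      show "(\<lambda>n. excess (z j (X (\<phi> n)))) \<longlonglongrightarrow> excess (\<zeta> j)"
        by (intro tendsto_excess lim j root_nonzero[OF root])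
      show "excess (\<zeta> j) \<noteq> 0"
      proof
        assume "excess (\<zeta> j) = 0"
        from curve_value_props(5)[OF lam root[OF j] this] curve_value_props(2)[OF lam]
        have "cmod (\<zeta> j) = cmod (z m lam)" by auto
        then show False using mod[OF j] modulus_separated[OF lam j] that by auto
      qed
    qed
    then have "eventually (\<lambda>n. \<forall>j\<in>{1..<m} \<union> {m+2..2*m}. (excess (z j (X (\<phi> n))) < 0 \<longleftrightarrow> excess (\<zeta> j) < 0) \<and>
        (0 < excess (z j (X (\<phi> n))) \<longleftrightarrow> 0 < excess (\<zeta> j))) sequentially"
      by (intro eventually_ball_finite) auto
    from eventually_happens'[OF sequentially_bot this]
    obtain n where n: "\<And>j. j \<in> {1..<m} \<union> {m+2..2*m} \<Longrightarrow> (excess (z j (X (\<phi> n))) < 0 \<longleftrightarrow> excess (\<zeta> j) < 0) \<and>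
        (0 < excess (z j (X (\<phi> n))) \<longleftrightarrow> 0 < excess (\<zeta> j))"
      by blast
    have small: "{w. poly (P lam) w = 0 \<and> cmod w < cmod (z m lam)} = \<zeta> ` {1..<m}"
      by (rule roots_by_modulus(1)[OF lam enum]) (rule mod)
    have large: "{w. poly (P lam) w = 0 \<and> cmod (z m lam) < cmod w} = \<zeta> ` {m+2..2*m}"
      by (rule roots_by_modulus(2)[OF lam enum]) (rule mod)
    have "g lam = ((\<forall>j\<in>{1..<m}. excess (\<zeta> j) < 0), (\<forall>j\<in>{m+2..2*m}. 0 < excess (\<zeta> j)))"
      unfolding g_def small large by simp
    moreover have "g (X (\<phi> n)) = ((\<forall>j\<in>{1..<m}. excess (z j (X (\<phi> n))) < 0),
        (\<forall>j\<in>{m+2..2*m}. 0 < excess (z j (X (\<phi> n)))))"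
      unfolding g_def roots_by_modulus(1,2)[OF X(1)[of "\<phi> n"] roots_mset[of "X (\<phi> n)"] refl] by simp
    ultimately have "g (X (\<phi> n)) = g lam"
      using n by auto
    then show "\<exists>n. g (X n) = g lam" by blast
  qed
  then obtain c where c: "\<And>lam. lam \<in> curve_values \<Longrightarrow> g lam = c"
    unfolding constant_on_def by blast
  obtain \<theta>1 \<theta>2 where \<theta>: "\<theta>1 \<in> {-pi..pi}" "\<theta>2 \<in> {-pi..pi}"
    "\<And>w. w \<noteq> 0 \<Longrightarrow> r \<theta>1 \<le> radius w \<and> radius w \<le> r \<theta>2"
    using radius_bounds by blast
  have start: "f (curve t) \<in> curve_values \<and> cmod (z m (f (curve t))) = r t" if t: "t \<in> {-pi..pi}" for t
  proof
    show v: "f (curve t) \<in> curve_values" using t by (auto simp: curve_values_def)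
    have "poly (P (f (curve t))) (curve t) = 0"
      using curve_nonzero[OF t] by (simp add: poly_P_eq_0_iff)
    from curve_value_props(5)[OF v this excess_curve[OF t]] curve_value_props(2)[OF v]
    have "cmod (z m (f (curve t))) = cmod (curve t)" by auto
    then show "cmod (z m (f (curve t))) = r t"
      using r_pos[OF t] by (simp add: curve_def norm_mult)
  qed
  have "fst c"
    using c[of "f (curve \<theta>1)"] start[OF \<theta>(1)] \<theta>(3)[OF root_nonzero]
    by (force simp: g_def excess_def)
  moreover have "snd c"
    using c[of "f (curve \<theta>2)"] start[OF \<theta>(2)] \<theta>(3)[OF root_nonzero]
    by (force simp: g_def excess_def)
  ultimately have "g lam = (True, True)"
    using c[OF assms(1)] by (cases c) auto
  then show "cmod w < cmod (z m lam) \<Longrightarrow> excess w < 0" "cmod (z m lam) < cmod w \<Longrightarrow> 0 < excess w"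
    using assms(2) by (auto simp: g_def)
qed

lemma curve_value_ordered:
  assumes "lam \<in> curve_values" "poly (P lam) w = 0" "poly (P lam) v = 0" "excess w \<le> 0" "0 \<le> excess v"
  shows "cmod w \<le> cmod v"
  using side_of_roots_over_curve_values[OF assms(1,2)] side_of_roots_over_curve_values[OF assms(1,3)] assms(4,5) by force

definition inner_count :: "complex \<Rightarrow> nat" where
  "inner_count lam = size (filter_mset (\<lambda>w. excess w < 0) (proots (P lam)))"

lemma inner_count_enumeration:
  assumes "image_mset \<zeta> (mset_set {1..2 * m}) = proots (P lam)"
  shows "inner_count lam = card {j\<in>{1..2*m}. excess (\<zeta> j) < 0}"
  unfolding inner_count_def assms[symmetric]
  by (simp add: filter_mset_image_mset)

text \<open>
  Being connected, compact and real, \<open>curve_values\<close> is a segment, and the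
  complement of a bounded convex set in the plane is connected.
\<close>

lemma connected_complement: "connected (- curve_values)"
proof -
  have L: "curve_values = complex_of_real ` (Re ` curve_values)"
    using curve_values_real by (force simp: image_image)
  have "connected (Re ` curve_values)"
    by (intro connected_continuous_image connected_curve_values continuous_intros)
  then have "convex (Re ` curve_values)"
    by (simp add: is_interval_connected_1 is_interval_convex)
  then have "convex (complex_of_real ` (Re ` curve_values))"
    by (rule convex_linear_image[OF bounded_linear.linear[OF bounded_linear_of_real]])
  then have "convex curve_values" using L by simp
  then show ?thesis
    using path_connected_complement_bounded_convex[of curve_values] compact_curve_values
    by (auto intro: path_connected_imp_connected compact_imp_bounded)
qed

text \<open>
  A root can change sides only by crossing the curve, and then \<open>lam\<close> is a value of
  the symbol on the curve.
\<close>

lemma inner_count_constant: "inner_count constant_on (- curve_values)"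
  using connected_complement
proof (rule connected_sequentially_constant)
  fix lam X assume lam: "lam \<in> - curve_values" and X: "\<And>n::nat. X n \<in> - curve_values" "X \<longlonglongrightarrow> lam"
  obtain \<phi> \<zeta> where \<phi>: "strict_mono (\<phi> :: nat \<Rightarrow> nat)"
    and lim: "\<And>j. j \<in> {1..2*m} \<Longrightarrow> (\<lambda>n. z j (X (\<phi> n))) \<longlonglongrightarrow> \<zeta> j"
    and enum: "image_mset \<zeta> (mset_set {1..2 * m}) = proots (P lam)"
    using roots_subsequence[OF X(2)] by metis
  have root: "poly (P lam) (\<zeta> j) = 0" if "j \<in> {1..2*m}" for j
    using enumeration_set[OF enum] that by blast
  have "eventually (\<lambda>n. (excess (z j (X (\<phi> n))) < 0 \<longleftrightarrow> excess (\<zeta> j) < 0) \<and>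
      (0 < excess (z j (X (\<phi> n))) \<longleftrightarrow> 0 < excess (\<zeta> j))) sequentially" if j: "j \<in> {1..2*m}" for j
  proof (rule tendsto_eventually_same_sign)
    show "(\<lambda>n. excess (z j (X (\<phi> n)))) \<longlonglongrightarrow> excess (\<zeta> j)"
      by (intro tendsto_excess lim j root_nonzero[OF root])
    show "excess (\<zeta> j) \<noteq> 0"
      using excess_eq_0_imp_curve_value[of "\<zeta> j"] root[OF j] lam by (auto simp: poly_P_eq_0_iff)
  qed
  then have "eventually (\<lambda>n. \<forall>j\<in>{1..2*m}. (excess (z j (X (\<phi> n))) < 0 \<longleftrightarrow> excess (\<zeta> j) < 0) \<and>
      (0 < excess (z j (X (\<phi> n))) \<longleftrightarrow> 0 < excess (\<zeta> j))) sequentially"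
    by (intro eventually_ball_finite) auto
  from eventually_happens'[OF sequentially_bot this]
  obtain n where n: "\<And>j. j \<in> {1..2*m} \<Longrightarrow> (excess (z j (X (\<phi> n))) < 0 \<longleftrightarrow> excess (\<zeta> j) < 0) \<and>
      (0 < excess (z j (X (\<phi> n))) \<longleftrightarrow> 0 < excess (\<zeta> j))"
    by blast
  have "inner_count (X (\<phi> n)) = inner_count lam"
    unfolding inner_count_enumeration[OF enum] inner_count_enumeration[OF roots_mset[of "X (\<phi> n)"]]
    using n by (intro arg_cong[where f = card]) auto
  then show "\<exists>n. inner_count (X n) = inner_count lam" by blast
qed


text \<open>
  On an annulus the symbol is bounded, so for large \<open>lam\<close> every root is very small
  or very large.
\<close>

lemma large_real_dichotomy:
  assumes "0 < \<epsilon>"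
  shows "eventually (\<lambda>n. of_nat n \<notin> curve_values \<and> (\<forall>w. poly (P (of_nat n)) w = 0 \<longrightarrow>
           (excess w < 0 \<and> cmod w < \<epsilon>) \<or> (0 < excess w \<and> 1 / \<epsilon> < cmod w))) sequentially"
proof -
  obtain \<theta>1 \<theta>2 where \<theta>: "\<theta>1 \<in> {-pi..pi}" "\<theta>2 \<in> {-pi..pi}"
    "\<And>w. w \<noteq> 0 \<Longrightarrow> r \<theta>1 \<le> radius w \<and> radius w \<le> r \<theta>2"
    using radius_bounds by blast
  (* below this modulus a point is inside the curve, above its inverse outside *)
  define d where "d = min \<epsilon> (min (r \<theta>1) (1 / r \<theta>2))"
  have r12: "0 < r \<theta>1" "0 < r \<theta>2" using \<theta> r_pos by auto
  have d: "0 < d" "d \<le> \<epsilon>" "d \<le> r \<theta>1" "d \<le> 1 / r \<theta>2" using assms r12 by (auto simp: d_def)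
  have d': "1 / \<epsilon> \<le> 1 / d" "r \<theta>2 \<le> 1 / d" using d assms r12 by (auto simp: field_simps)
  define A where "A = cball 0 (1 / d) - ball (0::complex) d"
  have "compact A" unfolding A_def by (intro compact_diff) auto
  moreover have "continuous_on A f"
    using d(1) by (intro continuous_on_f continuous_on_id) (auto simp: A_def)
  ultimately have "bounded (f ` A \<union> curve_values)"
    by (intro bounded_Un[THEN iffD2] conjI compact_imp_bounded compact_continuous_image compact_curve_values)
  then obtain B where B: "\<And>x. x \<in> f ` A \<union> curve_values \<Longrightarrow> cmod x \<le> B"
    unfolding bounded_iff by blast
  have "eventually (\<lambda>n. B < real n) sequentially"
    using filterlim_real_sequentially by (auto simp: filterlim_at_top_dense)
  then show ?thesis
  proof eventually_elim
    case (elim n)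
    show ?case
    proof (intro conjI allI impI)
      show "of_nat n \<notin> curve_values" using B[of "of_nat n"] elim by auto
      fix w assume w: "poly (P (of_nat n)) w = 0"
      then have "w \<noteq> 0" "f w = of_nat n" by (auto simp: poly_P_eq_0_iff)
      then have "w \<notin> A" using B[of "of_nat n"] elim by force
      then consider "cmod w < d" | "1 / d < cmod w" by (auto simp: A_def)
      then show "(excess w < 0 \<and> cmod w < \<epsilon>) \<or> (0 < excess w \<and> 1 / \<epsilon> < cmod w)"
        using d d' \<theta>(3)[OF \<open>w \<noteq> 0\<close>] by cases (auto simp: excess_def)
    qed
  qed
qed

text \<open>
  The number \<open>k\<close> of inner roots is read off from \<open>P lam\<close> at the points
  2 and 1 as \<open>lam\<close> tends to infinity. A small root contributes a factor tending to
  2 to the quotient of the two values, a large root a factor tending to 1, so the quotient tends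
  to \<open>2 ^ k\<close>; but \<open>P lam\<close> is dominated by \<open>- lam * X ^
  m\<close>, so it tends to \<open>2 ^ m\<close>.
\<close>

lemma inner_count_eq_m:
  assumes "lam \<notin> curve_values"
  shows "inner_count lam = m"
proof -
  obtain k where k: "\<And>l. l \<notin> curve_values \<Longrightarrow> inner_count l = k"
    using inner_count_constant unfolding constant_on_def by auto
  define X where "X = (\<lambda>n. of_nat n :: complex)"
  have inner_iff: "eventually (\<lambda>n. \<forall>j\<in>{1..2*m}. excess (z j (X n)) < 0 \<longleftrightarrow> j \<le> k) sequentially"
    and k_le: "k \<le> 2 * m"
  proof -
    have ev: "eventually (\<lambda>n. k \<le> 2 * m \<and> (\<forall>j\<in>{1..2*m}. excess (z j (X n)) < 0 \<longleftrightarrow> j \<le> k)) sequentially"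
      using large_real_dichotomy[of 1, simplified]
    proof eventually_elim
      case (elim n)
      let ?S = "{j\<in>{1..2*m}. excess (z j (X n)) < 0}"
      have side: "(excess w < 0 \<and> cmod w < 1) \<or> (0 < excess w \<and> 1 < cmod w)" if "poly (P (X n)) w = 0" for w
        using elim that unfolding X_def by simp
      have down: "i \<in> ?S" if "j \<in> ?S" "1 \<le> i" "i \<le> j" for i j
      proof -
        have j: "j \<in> {1..2*m}" "excess (z j (X n)) < 0" using that by auto
        then have i: "i \<in> {1..2*m}" using that by auto
        have "cmod (z j (X n)) < 1" using side[OF root_z[OF j(1)]] j(2) by linarith
        moreover have "cmod (z i (X n)) \<le> cmod (z j (X n))" using that j by (intro modulus_mono) auto
        ultimately have "excess (z i (X n)) < 0" using side[OF root_z[OF i]] by linarith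
        then show ?thesis using i by simp
      qed
      have card: "card ?S = k"
        using k[of "X n"] elim inner_count_enumeration[OF roots_mset] unfolding X_def by metis
      have eqk: "?S = {1..k}"
      proof (cases "?S = {}")
        case True
        have "k = 0" using card unfolding True by simp
        then show ?thesis unfolding True by simp
      next
        case False
        have fin: "finite ?S" by simp
        define M where "M = Max ?S"
        have eqM: "?S = {1..M}"
        proof (intro equalityI subsetI)
          fix j assume "j \<in> ?S"
          then show "j \<in> {1..M}" using Max_ge[OF fin] unfolding M_def by auto
        next
          fix j assume "j \<in> {1..M}"
          then show "j \<in> ?S" using down[OF Max_in[OF fin False], of j] unfolding M_def by auto
        qed
        have "k = M" using card unfolding eqM by simp
        then show ?thesis unfolding eqM by simp
      qed
      have "k \<le> 2 * m"
      proof -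
        have "card ?S \<le> card {1..2*m}" by (intro card_mono) auto
        then show ?thesis unfolding card by simp
      qed
      moreover have "excess (z j (X n)) < 0 \<longleftrightarrow> j \<le> k" if "j \<in> {1..2*m}" for j
      proof -
        have "j \<in> ?S \<longleftrightarrow> j \<in> {1..k}" unfolding eqk ..
        then show ?thesis using that by simp
      qed
      ultimately show ?case by blast
    qed
    then show "eventually (\<lambda>n. \<forall>j\<in>{1..2*m}. excess (z j (X n)) < 0 \<longleftrightarrow> j \<le> k) sequentially"
      by eventually_elim simp
    from eventually_happens'[OF sequentially_bot ev] show "k \<le> 2 * m" by blast
  qed
  have small: "(\<lambda>n. z j (X n)) \<longlonglongrightarrow> 0" if j: "j \<in> {1..2*m}" "j \<le> k" for j
  proof (rule tendstoI)
    fix \<epsilon> :: real assume "0 < \<epsilon>"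
    from large_real_dichotomy[OF this] inner_iff
    show "eventually (\<lambda>n. dist (z j (X n)) 0 < \<epsilon>) sequentially"
    proof eventually_elim
      case (elim n)
      have "poly (P (X n)) (z j (X n)) = 0" using j(1) by (rule root_z)
      moreover have "excess (z j (X n)) < 0" using elim(2) j by blast
      ultimately show ?case using elim(1) unfolding X_def by force
    qed
  qed
  have large: "(\<lambda>n. inverse (z j (X n))) \<longlonglongrightarrow> 0" if j: "j \<in> {1..2*m}" "k < j" for j
  proof (rule tendstoI)
    fix \<epsilon> :: real assume \<epsilon>: "0 < \<epsilon>"
    from large_real_dichotomy[OF this] inner_iff
    show "eventually (\<lambda>n. dist (inverse (z j (X n))) 0 < \<epsilon>) sequentially"
    proof eventually_elim
      case (elim n)
      have root: "poly (P (X n)) (z j (X n)) = 0" using j(1) by (rule root_z)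
      moreover have "\<not> excess (z j (X n)) < 0" using elim(2) j by auto
      ultimately have "1 / \<epsilon> < cmod (z j (X n))" using elim(1) unfolding X_def by force
      moreover have "0 < cmod (z j (X n))" using root_nonzero[OF root] by simp
      ultimately show ?case using \<epsilon> unfolding dist_norm diff_zero norm_inverse by (simp add: field_simps)
    qed
  qed
  define h where "h = (\<lambda>w::complex. (2 - w) / (1 - w))"
  have factor: "(\<lambda>n. h (z j (X n))) \<longlonglongrightarrow> (if j \<le> k then 2 else 1)" if j: "j \<in> {1..2*m}" for j
  proof (cases "j \<le> k")
    case True
    have "(\<lambda>n. h (z j (X n))) \<longlonglongrightarrow> (2 - 0) / (1 - 0)"
      unfolding h_def by (intro tendsto_intros small j True) auto
    then show ?thesis using True by simp
  next
    case False
    have "h (z j (X n)) = (2 * inverse (z j (X n)) - 1) / (inverse (z j (X n)) - 1)" for n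
    proof -
      have nz: "z j (X n) \<noteq> 0" using root_nonzero[OF root_z[OF j]] .
      have "2 * inverse (z j (X n)) - 1 = (2 - z j (X n)) * inverse (z j (X n))"
        "inverse (z j (X n)) - 1 = (1 - z j (X n)) * inverse (z j (X n))"
        using nz by (auto simp: algebra_simps)
      then show ?thesis using nz unfolding h_def by simp
    qed
    moreover have "(\<lambda>n. (2 * inverse (z j (X n)) - 1) / (inverse (z j (X n)) - 1)) \<longlonglongrightarrow> (2 * 0 - 1) / (0 - 1)"
      using False by (intro tendsto_intros large j) auto
    ultimately show ?thesis using False by simp
  qed
  have "(\<lambda>n. \<Prod>j\<in>{1..2*m}. h (z j (X n))) \<longlonglongrightarrow> (\<Prod>j\<in>{1..2*m}. if j \<le> k then 2 else 1)"
    by (intro tendsto_prod factor)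
  moreover have "(\<Prod>j\<in>{1..2*m}. if j \<le> k then 2 else 1) = (2 ^ k :: complex)"
  proof -
    have "{j\<in>{1..2*m}. j \<le> k} = {1..k}" using k_le by auto
    then show ?thesis by (simp add: prod.If_cases Int_def)
  qed
  moreover have "(\<Prod>j\<in>{1..2*m}. h (z j (X n))) = poly (P (X n)) 2 / poly (P (X n)) 1" for n
    using a_bot by (simp add: P_factor poly_prod h_def prod_dividef)
  ultimately have lim1: "(\<lambda>n. poly (P (X n)) 2 / poly (P (X n)) 1) \<longlonglongrightarrow> 2 ^ k" by simp
  have P_eq: "poly (P l) w = poly (P 0) w - l * w ^ m" for l w
    by (simp add: char_laurent_poly_def poly_monom)
  have inv: "(\<lambda>n. inverse (X n)) \<longlonglongrightarrow> 0"
    using lim_1_over_n[where 'a = complex] by (simp add: X_def inverse_eq_divide)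
  have "(\<lambda>n. (poly (P 0) 2 * inverse (X n) - 2 ^ m) / (poly (P 0) 1 * inverse (X n) - 1))
      \<longlonglongrightarrow> (poly (P 0) 2 * 0 - 2 ^ m) / (poly (P 0) 1 * 0 - 1)"
    by (intro tendsto_intros inv) auto
  moreover have "eventually (\<lambda>n. (poly (P 0) 2 * inverse (X n) - 2 ^ m) / (poly (P 0) 1 * inverse (X n) - 1)
      = poly (P (X n)) 2 / poly (P (X n)) 1) sequentially"
    using eventually_gt_at_top[of 0]
  proof eventually_elim
    case (elim n)
    then have nz: "X n \<noteq> 0" by (simp add: X_def)
    have "poly (P 0) 2 * inverse (X n) - 2 ^ m = poly (P (X n)) 2 * inverse (X n)"
      "poly (P 0) 1 * inverse (X n) - 1 = poly (P (X n)) 1 * inverse (X n)"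
      using nz by (auto simp: P_eq[of "X n"] algebra_simps)
    then show ?case using nz by simp
  qed
  ultimately have "(\<lambda>n. poly (P (X n)) 2 / poly (P (X n)) 1) \<longlonglongrightarrow> 2 ^ m"
    by (simp add: tendsto_cong)
  from LIMSEQ_unique[OF lim1 this] have "(2::complex) ^ k = 2 ^ m" .
  then have "cmod (2 ^ k) = cmod (2 ^ m)" by simp
  then have "k = m" by (simp add: norm_power)
  then show ?thesis using k assms by simp
qed

text \<open>
  There are exactly \<open>m\<close> inner roots. Either these are \<open>z 1 lam, \<dots>, z m
  lam\<close>, and then the two middle roots form the pair, or some inner root comes after some
  outer root in the sorted order.
\<close>

lemma crossing_pair:
  assumes lam: "lam \<notin> curve_values" and eq: "\<not> cmod (z m lam) < cmod (z (m + 1) lam)"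
  obtains w v where "f w = lam" "f v = lam" "w \<noteq> 0" "v \<noteq> 0" "excess w < 0" "0 < excess v" "cmod v \<le> cmod w"
proof -
  let ?S = "{j\<in>{1..2*m}. excess (z j lam) < 0}"
  have card: "card ?S = m"
    using inner_count_eq_m[OF lam] inner_count_enumeration[OF roots_mset] by metis
  have gap_nz: "excess (z j lam) \<noteq> 0" if "j \<in> {1..2*m}" for j
    using excess_eq_0_imp_curve_value[of "z j lam"] root_z[OF that] lam by (auto simp: poly_P_eq_0_iff)
  have "\<exists>i j. i \<in> ?S \<and> j \<in> {1..2*m} - ?S \<and> cmod (z j lam) \<le> cmod (z i lam)"
  proof (cases "?S = {1..m}")
    case True
    have "m \<in> ?S" "m + 1 \<notin> ?S" unfolding True using m_pos by auto
    then show ?thesis using eq m_index by (intro exI[of _ m] exI[of _ "m + 1"]) auto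
  next
    case False
    have "\<not> ?S \<subseteq> {1..m}" using False card by (metis card_atLeastAtMost card_subset_eq diff_Suc_1 finite_atLeastAtMost One_nat_def)
    then obtain i where "i \<in> ?S" "i \<notin> {1..m}" by blast
    then have i: "i \<in> ?S" "m < i" by auto
    have "\<not> {1..m} \<subseteq> ?S"
    proof
      assume "{1..m} \<subseteq> ?S"
      then have "{1..m} = ?S" using card by (intro card_subset_eq) auto
      then show False using False by simp
    qed
    then obtain j where j: "j \<in> {1..m}" "j \<notin> ?S" by blast
    have "cmod (z j lam) \<le> cmod (z i lam)" using i j by (intro modulus_mono) auto
    then show ?thesis using i j by (intro exI[of _ i] exI[of _ j]) auto
  qed
  then obtain i j where ij: "i \<in> ?S" "j \<in> {1..2*m}" "j \<notin> ?S" "cmod (z j lam) \<le> cmod (z i lam)" by blast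
  show thesis
    using that[of "z i lam" "z j lam"] ij root_z[of i lam] root_z[of j lam] gap_nz[of j]
    by (auto simp: poly_P_eq_0_iff)
qed


text \<open>
  Such a symmetry on an infinite set is an identity of Laurent polynomials, and its extreme
  coefficient shows that \<open>u ^ m = 1\<close>. For a point \<open>x\<close> of the curve,
  \<open>x\<close>, \<open>cnj x\<close> and \<open>u * x\<close> are then roots of equal
  modulus for the same real \<open>lam\<close>. They are distinct for a suitable direction
  \<open>\<theta>\<close>, while only two roots share the modulus of the middle ones.
\<close>

lemma no_rotational_symmetry:
  assumes u: "u \<noteq> 0" "u \<noteq> 1" and inf: "infinite S"
    and sym: "\<And>x. x \<in> S \<Longrightarrow> x \<noteq> 0 \<and> f (u * x) = f x"
  shows False
proof -
  define c where "c k = complex_of_real (a k) * (u powi (- k) - 1)" for k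
  define E where "E = (\<Sum>k\<in>{- int m..int m}. monom (c k) (nat (int m - k)))"
  have diff: "f (u * x) - f x = (\<Sum>k\<in>{- int m..int m}. c k * x powi (- k))" for x
    unfolding laurent_def c_def sum_subtractf[symmetric]
    by (intro sum.cong refl) (simp add: power_int_mult_distrib algebra_simps)
  have "poly E x = 0" if x: "x \<in> S" for x
  proof -
    have nz: "x \<noteq> 0" using sym[OF x] by simp
    have "poly E x = (\<Sum>k\<in>{- int m..int m}. x ^ m * (c k * x powi (- k)))"
      unfolding E_def poly_sum poly_monom
    proof (intro sum.cong refl)
      fix k assume k: "k \<in> {- int m..int m}"
      have "x ^ nat (int m - k) = x powi (int m - k)" using k by (simp add: power_int_def)
      also have "\<dots> = x ^ m * x powi (- k)"
        using nz power_int_add[of x "int m" "- k"] by simp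
      finally show "c k * x ^ nat (int m - k) = x ^ m * (c k * x powi (- k))" by simp
    qed
    also have "\<dots> = x ^ m * (f (u * x) - f x)"
      unfolding diff sum_distrib_left ..
    finally show ?thesis using sym[OF x] by simp
  qed
  then have "S \<subseteq> {x. poly E x = 0}" by blast
  then have "E = 0" using inf poly_roots_finite finite_subset by blast
  have c0: "c k = 0" if k: "k \<in> {- int m..int m}" for k
  proof -
    have "coeff E (nat (int m - k)) = (\<Sum>l\<in>{- int m..int m}. if l = k then c l else 0)"
      unfolding E_def coeff_sum using k by (intro sum.cong) auto
    also have "\<dots> = c k" using k by (subst sum.delta) auto
    finally show ?thesis using \<open>E = 0\<close> by simp
  qed
  then have sym_all: "f (u * x) = f x" for x
    using diff[of x] by simp
  have "c (int m) = 0" by (intro c0) auto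
  then have "u powi (- int m) = 1" using a_top by (simp add: c_def)
  then have "u ^ m = 1" by (simp add: power_int_minus)
  then have "cmod u ^ m = 1 ^ m" by (simp flip: norm_power)
  then have norm_u: "cmod u = 1"
    using m_pos by (intro power_eq_imp_eq_base[of "cmod u" m 1]) auto
  (* the direction pi / 2 fails only when u * x = cnj x, that is for u = -1 *)
  define \<theta> where "\<theta> = (if u = -1 then pi / 3 else pi / 2)"
  have \<theta>: "\<theta> \<in> {-pi..pi}" by (auto simp: \<theta>_def)
  define x where "x = curve \<theta>"
  have rx: "0 < r \<theta>" using r_pos[OF \<theta>] .
  have x_nz: "x \<noteq> 0" unfolding x_def using \<theta> by (rule curve_nonzero)
  have fx: "f x \<in> curve_values" using \<theta> by (auto simp: x_def curve_values_def)
  have "cnj x \<noteq> x"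
    using rx by (auto simp: x_def curve_def \<theta>_def complex_eq_iff sin_60)
  moreover have "u * x \<noteq> x" using u x_nz by simp
  moreover have "cnj x \<noteq> u * x"
  proof (cases "u = -1")
    case True
    then show ?thesis using rx by (simp add: x_def curve_def \<theta>_def complex_eq_iff cos_60)
  next
    case False
    have "x = complex_of_real (r \<theta>) * \<i>" using False by (simp add: x_def curve_def \<theta>_def cis_pi_half)
    then have "cnj x = - x" by simp
    then show ?thesis using False x_nz by (metis mult_cancel_right mult_minus1)
  qed
  ultimately have card: "card {x, cnj x, u * x} = 3" by auto
  have root: "poly (P (f x)) y = 0 \<and> cmod y = cmod (z m (f x))" if "y \<in> {x, cnj x, u * x}" for y
  proof -
    have "f x = cnj (f x)" using curve_value_props(1)[OF fx] by (simp add: complex_is_Real_iff complex_eq_iff)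
    then have fy: "f y = f x" using that sym_all by (auto simp: f_cnj)
    have "y \<noteq> 0" using that x_nz u by auto
    have "poly (P (f x)) x = 0" using x_nz by (simp add: poly_P_eq_0_iff)
    from curve_value_props(5)[OF fx this] excess_curve[OF \<theta>] curve_value_props(2)[OF fx]
    have "cmod x = cmod (z m (f x))" by (auto simp: x_def)
    then show ?thesis using that fy \<open>y \<noteq> 0\<close> norm_u by (auto simp: poly_P_eq_0_iff norm_mult)
  qed
  have "{x, cnj x, u * x} \<subseteq> {w. poly (P (f x)) w = 0 \<and> cmod w = cmod (z m (f x))}"
    using root by blast
  also have "\<dots> = (\<lambda>j. z j (f x)) ` {m, m + 1}"
    by (rule roots_by_modulus(3)[OF fx roots_mset]) (rule refl)
  finally have "card {x, cnj x, u * x} \<le> card ((\<lambda>j. z j (f x)) ` {m, m + 1})"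
    by (intro card_mono) auto
  also have "\<dots> \<le> card {m, m + 1}" by (intro card_image_le) auto
  finally show False using card by simp
qed

text \<open>
  A pair with the sides of the curve and the moduli in the wrong order. Points on the curve are
  admitted to make the set of such pairs compact.
\<close>

definition crossed :: "complex \<Rightarrow> complex \<Rightarrow> bool" where
  "crossed w v \<longleftrightarrow> w \<noteq> 0 \<and> v \<noteq> 0 \<and> f w = f v \<and> excess w \<le> 0 \<and> 0 \<le> excess v \<and> cmod v \<le> cmod w"

lemma uniform_limit_f:
  assumes "compact K" "0 \<notin> K" "u \<noteq> 0" "t \<longlonglongrightarrow> (1::complex)"
  shows "uniform_limit K (\<lambda>n x. f (u * t n * x) - f x) (\<lambda>x. f (u * x) - f x) sequentially"
proof -
  have const: "uniform_limit K (\<lambda>n x. s n) (\<lambda>x. l) sequentially" if "s \<longlonglongrightarrow> l" for s and l :: complex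
    using that by (auto simp: uniform_limit_iff tendsto_iff elim: eventually_mono)
  have eq: "f (u * t n * x) = (\<Sum>k\<in>{- int m..int m}. (complex_of_real (a k) * (u * t n) powi (- k)) * x powi (- k))" for n x
    unfolding laurent_def by (intro sum.cong refl) (simp add: power_int_mult_distrib)
  have eq': "f (u * x) = (\<Sum>k\<in>{- int m..int m}. (complex_of_real (a k) * u powi (- k)) * x powi (- k))" for x
    unfolding laurent_def by (intro sum.cong refl) (simp add: power_int_mult_distrib)
  have bdd: "bounded ((\<lambda>x. x powi k) ` K)" for k :: int
    by (intro compact_imp_bounded compact_continuous_image continuous_intros assms) (use assms in auto)
  have ut: "(\<lambda>n. u * t n) \<longlonglongrightarrow> u"
    using tendsto_mult[OF tendsto_const assms(4), of u] by simp
  have "uniform_limit K (\<lambda>n x. f (u * t n * x)) (\<lambda>x. f (u * x)) sequentially"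
    unfolding eq eq'
  proof (rule uniform_limit_finite_sum)
    fix k :: int
    show "uniform_limit K (\<lambda>n x. complex_of_real (a k) * (u * t n) powi (- k) * x powi (- k))
        (\<lambda>x. complex_of_real (a k) * u powi (- k) * x powi (- k)) sequentially"
    proof (rule uniform_lim_mult)
      show "uniform_limit K (\<lambda>n x. complex_of_real (a k) * (u * t n) powi (- k))
          (\<lambda>x. complex_of_real (a k) * u powi (- k)) sequentially"
        by (intro const tendsto_intros ut assms)
      show "bounded ((\<lambda>x. complex_of_real (a k) * u powi (- k)) ` K)"
        by (simp add: image_constant_conv)
    qed (intro uniform_limit_const bdd)+
  qed simp
  then show ?thesis
    by (intro uniform_limit_minus uniform_limit_const)
qed

text \<open>
  With \<open>u = w / v\<close>, the functions \<open>\<lambda>x. f (u * t n * x) - f x\<close>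
  with \<open>t n\<close> decreasing to 1 converge to \<open>\<lambda>x. f (u * x) - f
  x\<close>, which vanishes at \<open>v\<close>. Off \<open>curve_values\<close> the points
  \<open>w\<close> and \<open>v\<close> are strictly inside and outside, so a zero
  \<open>x\<close> of one of these functions near \<open>v\<close> yields the crossed pair
  \<open>(u * t n * x, x)\<close> with a larger quotient. By Hurwitz such zeros exist.
\<close>

lemma crossed_improve:
  assumes cr: "crossed w v" and off: "f w \<notin> curve_values"
  obtains w' v' where "crossed w' v'" "cmod w / cmod v < cmod w' / cmod v'"
proof (rule ccontr)
  assume "\<not> thesis"
  then have max: "\<And>w' v'. crossed w' v' \<Longrightarrow> cmod w' / cmod v' \<le> cmod w / cmod v"
    using that by (meson not_le)
  have nz: "w \<noteq> 0" "v \<noteq> 0" and fwv: "f w = f v" and le: "cmod v \<le> cmod w"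
    using cr by (auto simp: crossed_def)
  have "excess w \<noteq> 0" "excess v \<noteq> 0"
    using off fwv nz excess_eq_0_imp_curve_value by metis+
  then have gaps: "excess w < 0" "0 < excess v" using cr by (auto simp: crossed_def)
  define u where "u = w / v"
  have u: "u \<noteq> 0" "u \<noteq> 1" "u * v = w" using nz gaps by (auto simp: u_def)
  have norm_u: "1 \<le> cmod u" using nz le by (simp add: u_def norm_divide)
  have "eventually (\<lambda>y. 0 < excess y) (nhds v)"
    using order_tendstoD(1)[OF tendsto_excess[OF filterlim_ident nz(2)] gaps(2)] .
  moreover have "((\<lambda>y. u * y) \<longlongrightarrow> w) (nhds v)"
    using tendsto_mult[OF tendsto_const filterlim_ident, of u v] u(3) by simp
  from order_tendstoD(2)[OF tendsto_excess[OF this nz(1)] gaps(1)]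
  have "eventually (\<lambda>y. excess (u * y) < 0) (nhds v)" .
  moreover have "eventually (\<lambda>y. y \<noteq> 0) (nhds v)"
    using nz(2) by (rule t1_space_nhds)
  ultimately have "eventually (\<lambda>y. y \<noteq> 0 \<and> 0 < excess y \<and> excess (u * y) < 0) (nhds v)"
    by eventually_elim auto
  then obtain d where d: "0 < d" "\<And>y. dist y v < d \<Longrightarrow> y \<noteq> 0 \<and> 0 < excess y \<and> excess (u * y) < 0"
    unfolding eventually_nhds_metric by blast
  define S where "S = ball v (d / 2)"
  have S: "x \<noteq> 0" "0 < excess x" if "x \<in> S" for x
    using d(2)[of x] that d(1) by (auto simp: S_def dist_commute)
  define \<tau> where "\<tau> n = 1 + inverse (real (Suc n))" for n
  have \<tau>: "\<tau> \<longlonglongrightarrow> 1"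
    using tendsto_add[OF tendsto_const LIMSEQ_inverse_real_of_nat, of 1] by (simp add: \<tau>_def[abs_def])
  have "(\<lambda>n. (\<tau> n - 1) * (cmod v + d / 2)) \<longlonglongrightarrow> (1 - 1) * (cmod v + d / 2)"
    by (intro tendsto_intros \<tau>)
  then have "eventually (\<lambda>n. (\<tau> n - 1) * (cmod v + d / 2) < d / 2) sequentially"
    using d(1) by (intro order_tendstoD(2)) auto
  then obtain N where N: "\<And>n. N \<le> n \<Longrightarrow> (\<tau> n - 1) * (cmod v + d / 2) < d / 2"
    by (auto simp: eventually_sequentially)
  define t where "t n = complex_of_real (\<tau> (n + N))" for n
  have \<tau>_gt: "1 < \<tau> n" for n by (simp add: \<tau>_def)
  have t_lim: "t \<longlonglongrightarrow> 1"
    using tendsto_of_real[OF LIMSEQ_ignore_initial_segment[OF \<tau>, of N], where ?'a = complex]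
    by (simp add: t_def[abs_def])
  have t_gap: "excess (u * t n * x) < 0" if x: "x \<in> S" for n x
  proof -
    have "cmod x \<le> cmod v + d / 2"
      using x norm_triangle_ineq2[of x v] by (simp add: S_def dist_norm norm_minus_commute)
    then have "(\<tau> (n + N) - 1) * cmod x \<le> (\<tau> (n + N) - 1) * (cmod v + d / 2)"
      using \<tau>_gt[of "n + N"] by (intro mult_left_mono) auto
    also have "\<dots> < d / 2" by (rule N) simp
    finally have "(\<tau> (n + N) - 1) * cmod x < d / 2" .
    moreover have "t n - 1 = complex_of_real (\<tau> (n + N) - 1)" by (simp add: t_def)
    ultimately have "cmod ((t n - 1) * x) < d / 2"
      using \<tau>_gt[of "n + N"] by (simp only: norm_mult norm_of_real)
    moreover have "cmod (x - v) < d / 2" using x by (simp add: S_def dist_norm norm_minus_commute)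
    ultimately have "cmod ((t n - 1) * x) + cmod (x - v) < d / 2 + d / 2"
      by (rule add_strict_mono)
    then have lt: "cmod ((t n - 1) * x) + cmod (x - v) < d"
      by (simp only: field_sum_of_halves)
    have "t n * x - v = (t n - 1) * x + (x - v)" by (simp add: algebra_simps)
    then have "dist (t n * x) v < d"
      unfolding dist_norm using le_less_trans[OF norm_triangle_ineq lt] by (simp only:)
    from d(2)[OF this] show ?thesis by (simp add: mult.assoc)
  qed
  have t_nz: "t n \<noteq> 0" for n using \<tau>_gt[of "n + N"] by (simp add: t_def)
  define g where "g = (\<lambda>x. f (u * x) - f x)"
  have "g v \<noteq> 0"
  proof (rule Hurwitz_no_zeros[of S "\<lambda>n x. f (u * t n * x) - f x" g v])
    show "open S" and "connected S" and "v \<in> S" using d(1) by (auto simp: S_def)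
    show "(\<lambda>x. f (u * t n * x) - f x) holomorphic_on S" for n
      using u t_nz S by (intro holomorphic_intros) auto
    show "g holomorphic_on S"
      unfolding g_def using u S by (intro holomorphic_intros) auto
    show "uniform_limit K (\<lambda>n x. f (u * t n * x) - f x) g sequentially" if "compact K" "K \<subseteq> S" for K
      unfolding g_def using that S u t_lim by (intro uniform_limit_f) auto
    show "\<not> g constant_on S"
    proof
      assume "g constant_on S"
      then obtain c where c: "\<And>x. x \<in> S \<Longrightarrow> g x = c" unfolding constant_on_def by blast
      have "v \<in> S" using d(1) by (simp add: S_def)
      moreover have "g v = 0" using fwv u by (simp add: g_def)
      ultimately have "c = 0" using c by metis
      have "infinite S"
        using finite_imp_not_open[of S] \<open>v \<in> S\<close> unfolding S_def by blast
      moreover have "x \<noteq> 0 \<and> f (u * x) = f x" if "x \<in> S" for x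
        using S(1)[OF that] c[OF that] \<open>c = 0\<close> by (simp add: g_def)
      ultimately show False using no_rotational_symmetry u by blast
    qed
    show "f (u * t n * x) - f x \<noteq> 0" if x: "x \<in> S" for n x
    proof
      assume zero: "f (u * t n * x) - f x = 0"
      have norm_ut: "cmod (u * t n) = cmod u * \<tau> (n + N)"
        using \<tau>_gt[of "n + N"] by (simp add: norm_mult t_def)
      have big: "cmod u < cmod (u * t n)"
        unfolding norm_ut using mult_strict_left_mono[OF \<tau>_gt[of "n + N"], of "cmod u"] norm_u u(1) by simp
      have "1 * cmod x \<le> cmod (u * t n) * cmod x"
        using big norm_u by (intro mult_right_mono) auto
      then have "crossed (u * t n * x) x"
        using zero u t_nz S[OF x] t_gap[OF x, of n] by (simp add: crossed_def norm_mult)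
      from max[OF this] have "cmod (u * t n) \<le> cmod u"
        using S[OF x] by (simp add: norm_mult u_def norm_divide)
      then show False using big by simp
    qed
  qed
  then show False using fwv u by (simp add: g_def)
qed

text \<open>
  The conditions confine both points to the annulus between the least and the largest radius of
  the curve, so the crossed pairs form a compact set.
\<close>

lemma crossed_maximum:
  assumes "crossed w v"
  obtains w0 v0 where "crossed w0 v0" "\<And>w v. crossed w v \<Longrightarrow> cmod w / cmod v \<le> cmod w0 / cmod v0"
proof -
  obtain \<theta>1 \<theta>2 where \<theta>: "\<theta>1 \<in> {-pi..pi}" "\<theta>2 \<in> {-pi..pi}"
    "\<And>w. w \<noteq> 0 \<Longrightarrow> r \<theta>1 \<le> radius w \<and> radius w \<le> r \<theta>2"
    using radius_bounds by blast
  have r1: "0 < r \<theta>1" using \<theta> r_pos by auto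
  define A where "A = cball 0 (r \<theta>2) - ball (0::complex) (r \<theta>1)"
  have A0: "x \<noteq> 0" if "x \<in> A" for x using that r1 by (auto simp: A_def)
  have cA: "compact (A \<times> A)" unfolding A_def by (intro compact_Times compact_diff) auto
  define K where "K = {p \<in> A \<times> A. crossed (fst p) (snd p)}"
  have mem: "crossed w v \<longleftrightarrow> (w, v) \<in> K" for w v
  proof
    assume c: "crossed w v"
    then have "cmod w \<le> r \<theta>2" "r \<theta>1 \<le> cmod v" "cmod v \<le> cmod w"
      using \<theta>(3)[of w] \<theta>(3)[of v] by (auto simp: crossed_def excess_def)
    then show "(w, v) \<in> K" using c by (auto simp: K_def A_def)
  qed (simp add: K_def)
  have cgap: "continuous_on (A \<times> A) (\<lambda>p. excess (fst p))" "continuous_on (A \<times> A) (\<lambda>p. excess (snd p))"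
    by (rule continuous_on_compose2[OF continuous_on_excess]; use A0 in \<open>auto intro!: continuous_intros\<close>)+
  have cf: "continuous_on (A \<times> A) (\<lambda>p. f (fst p))" "continuous_on (A \<times> A) (\<lambda>p. f (snd p))"
    by (intro continuous_intros; use A0 in auto)+
  have cl: "closed (A \<times> A)" using cA by (rule compact_imp_closed)
  have "K = {p \<in> A \<times> A. f (fst p) - f (snd p) \<in> {0}} \<inter> {p \<in> A \<times> A. excess (fst p) \<in> {..0}}
      \<inter> {p \<in> A \<times> A. excess (snd p) \<in> {0..}} \<inter> {p \<in> A \<times> A. cmod (fst p) - cmod (snd p) \<in> {0..}}"
    using A0 by (auto simp: K_def crossed_def)
  moreover have "closed {p \<in> A \<times> A. f (fst p) - f (snd p) \<in> {0}}"
    "closed {p \<in> A \<times> A. excess (fst p) \<in> {..0}}" "closed {p \<in> A \<times> A. excess (snd p) \<in> {0..}}"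
    "closed {p \<in> A \<times> A. cmod (fst p) - cmod (snd p) \<in> {0..}}"
    by (rule continuous_closed_preimage[OF _ cl, unfolded vimage_def Int_def mem_Collect_eq];
        intro continuous_intros cf cgap closed_atMost closed_atLeast closed_singleton)+
  ultimately have "closed K" by (simp only: closed_Int)
  then have "compact ((A \<times> A) \<inter> K)" by (rule compact_Int_closed[OF cA])
  moreover have "(A \<times> A) \<inter> K = K" by (auto simp: K_def)
  ultimately have "compact K" by simp
  moreover have "K \<noteq> {}" using assms mem by blast
  moreover have "continuous_on K (\<lambda>p. cmod (fst p) / cmod (snd p))"
    by (intro continuous_intros) (use A0 in \<open>auto simp: K_def\<close>)
  ultimately obtain p where p: "p \<in> K" "\<forall>q\<in>K. cmod (fst q) / cmod (snd q) \<le> cmod (fst p) / cmod (snd p)"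
    using continuous_attains_sup by blast
  show thesis
  proof (rule that[of "fst p" "snd p"])
    show "crossed (fst p) (snd p)" using p(1) by (simp add: mem)
    show "cmod w / cmod v \<le> cmod (fst p) / cmod (snd p)" if "crossed w v" for w v
      using bspec[OF p(2) that[unfolded mem]] by simp
  qed
qed

text \<open>
  A maximal crossed pair cannot lie over the complement of \<open>curve_values\<close>. Over
  \<open>curve_values\<close> its quotient is at most 1, but then the pair obtained from
  \<open>lam\<close> is maximal as well, and that one lies over the complement.
\<close>

lemma middle_roots_separated:
  assumes lam: "lam \<notin> curve_values"
  shows "cmod (z m lam) < cmod (z (m + 1) lam)"
proof (rule ccontr)
  assume "\<not> ?thesis"
  from crossing_pair[OF lam this] obtain w v where wv: "f w = lam" "f v = lam" "w \<noteq> 0" "v \<noteq> 0"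
    "excess w < 0" "0 < excess v" "cmod v \<le> cmod w" by metis
  then have cr: "crossed w v" by (simp add: crossed_def)
  obtain w0 v0 where max: "crossed w0 v0" "\<And>w v. crossed w v \<Longrightarrow> cmod w / cmod v \<le> cmod w0 / cmod v0"
    using crossed_maximum[OF cr] by blast
  show False
  proof (cases "f w0 \<in> curve_values")
    case False
    from crossed_improve[OF max(1) this] max(2) show False by (metis not_le)
  next
    case True
    have "cmod w0 \<le> cmod v0"
      using max(1) by (intro curve_value_ordered[OF True]) (auto simp: crossed_def poly_P_eq_0_iff)
    then have "cmod w0 / cmod v0 \<le> 1" using max(1) by (simp add: crossed_def)
    also have "1 \<le> cmod w / cmod v" using wv by simp
    finally have "\<And>w' v'. crossed w' v' \<Longrightarrow> cmod w' / cmod v' \<le> cmod w / cmod v"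
      using max(2) by (meson order_trans)
    moreover have "f w \<notin> curve_values" using wv lam by simp
    ultimately show False using crossed_improve[OF cr] by (metis not_le)
  qed
qed

end

section \<open>Hausdorff convergence\<close>

context curve_symbol
begin

lemma spectrum_avoids_nbhd:
  assumes "lam \<notin> curve_values"
  obtains d N where "0 < d" "\<And>n l. N \<le> n \<Longrightarrow> dist l lam < d \<Longrightarrow> l \<notin> spectrum (toeplitz a m n)"
proof -
  obtain \<rho>1 \<rho>2 where \<rho>: "cmod (z m lam) < \<rho>1" "\<rho>1 < \<rho>2" "\<rho>2 < cmod (z (m + 1) lam)"
    using middle_roots_separated[OF assms] by (meson dense)
  have "0 \<le> \<rho>1" using norm_ge_zero[of "z m lam"] \<rho>(1) by linarith
  from spectrum_excluded_by_modulus_gap[OF this \<rho>(2)] obtain N where N: "\<And>n l. N \<le> n \<Longrightarrow> cmod (z m l) \<le> \<rho>1 \<Longrightarrow>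
      \<rho>2 \<le> cmod (z (m + 1) l) \<Longrightarrow> l \<notin> spectrum (toeplitz a m n)"
    by metis
  have cont: "((\<lambda>l. cmod (z j l)) \<longlongrightarrow> cmod (z j lam)) (nhds lam)" if "j \<in> {1..2*m}" for j
    using isCont_modulus[OF that, of lam] unfolding isCont_def
    by (rule tendsto_at_iff_tendsto_nhds[of "\<lambda>l. cmod (z j l)" lam, THEN iffD1])
  have "eventually (\<lambda>l. cmod (z m l) < \<rho>1) (nhds lam)" "eventually (\<lambda>l. \<rho>2 < cmod (z (m + 1) l)) (nhds lam)"
    using order_tendstoD(2)[OF cont[OF m_index(1)] \<rho>(1)] order_tendstoD(1)[OF cont[OF m_index(2)] \<rho>(3)] .
  then have "eventually (\<lambda>l. cmod (z m l) < \<rho>1 \<and> \<rho>2 < cmod (z (m + 1) l)) (nhds lam)"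
    by eventually_elim auto
  then obtain d where "0 < d" "\<And>l. dist l lam < d \<Longrightarrow> cmod (z m l) < \<rho>1 \<and> \<rho>2 < cmod (z (m + 1) l)"
    unfolding eventually_nhds_metric by blast
  with N that[of d N] show thesis by (meson less_imp_le)
qed

text \<open>
  The spectra lie in a fixed disc, and the part of it at distance at least
  \<open>\<delta>\<close> from \<open>curve_values\<close> is compact, hence covered by finitely
  many of the neighbourhoods just found.
\<close>

lemma spectrum_near_curve_values:
  assumes "0 < \<delta>"
  shows "eventually (\<lambda>n. \<forall>e\<in>spectrum (toeplitz a m n). \<exists>x\<in>curve_values. dist e x < \<delta>) sequentially"
proof -
  define K where "K = cball 0 symbol_norm - (\<Union>x\<in>curve_values. ball x \<delta>)"
  have "compact K" unfolding K_def by (intro compact_diff) auto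
  have "\<exists>d N. 0 < d \<and> (\<forall>n l. N \<le> n \<longrightarrow> dist l lam < d \<longrightarrow> l \<notin> spectrum (toeplitz a m n))" if "lam \<in> K" for lam
  proof -
    have "lam \<notin> curve_values" using that assms by (force simp: K_def)
    then show ?thesis using spectrum_avoids_nbhd by metis
  qed
  then obtain d N where dN: "\<And>lam. lam \<in> K \<Longrightarrow> 0 < d lam \<and>
      (\<forall>n l. N lam \<le> n \<longrightarrow> dist l lam < d lam \<longrightarrow> l \<notin> spectrum (toeplitz a m n))"
    by metis
  have "K \<subseteq> (\<Union>lam\<in>K. ball lam (d lam))" using dN by force
  then obtain T where T: "T \<subseteq> K" "finite T" "K \<subseteq> (\<Union>lam\<in>T. ball lam (d lam))"
    using compactE_image[OF \<open>compact K\<close>, of K "\<lambda>lam. ball lam (d lam)"] by auto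
  have "eventually (\<lambda>n. \<forall>lam\<in>T. N lam \<le> n) sequentially"
    using T(2) by (intro eventually_ball_finite) (auto intro: eventually_ge_at_top)
  then show ?thesis
  proof eventually_elim
    case (elim n)
    show ?case
    proof
      fix e assume e: "e \<in> spectrum (toeplitz a m n)"
      have "e \<notin> K"
      proof
        assume "e \<in> K"
        then obtain lam where "lam \<in> T" "dist e lam < d lam" using T(3) by (auto simp: dist_commute)
        then show False using dN elim e T(1) by blast
      qed
      then show "\<exists>x\<in>curve_values. dist e x < \<delta>"
        using spectrum_bound[OF e] by (auto simp: K_def dist_commute)
    qed
  qed
qed

text \<open>
  Approximation at each single point is made uniform by a finite net.
\<close>

lemma curve_values_near_spectrum:
  assumes "0 < \<delta>"
  shows "eventually (\<lambda>n. \<forall>x\<in>curve_values. \<exists>e\<in>spectrum (toeplitz a m n). dist e x < \<delta>) sequentially"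
proof -
  have cover: "curve_values \<subseteq> (\<Union>x\<in>curve_values. ball x (\<delta> / 2))"
  proof
    fix x assume "x \<in> curve_values"
    moreover have "x \<in> ball x (\<delta> / 2)" using assms by simp
    ultimately show "x \<in> (\<Union>x\<in>curve_values. ball x (\<delta> / 2))" by (rule UN_I)
  qed
  obtain T where T: "T \<subseteq> curve_values" "finite T" "curve_values \<subseteq> (\<Union>x\<in>T. ball x (\<delta> / 2))"
    using compactE_image[OF compact_curve_values _ cover] open_ball by blast
  have near: "eventually (\<lambda>n. \<forall>e\<in>spectrum (toeplitz a m n). \<exists>\<theta>\<in>{-pi..pi}. dist e (f (curve \<theta>)) < \<delta>') sequentially"
    if "0 < \<delta>'" for \<delta>'
    using spectrum_near_curve_values[OF that] unfolding curve_values_def by simp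
  have "eventually (\<lambda>n. \<exists>e\<in>spectrum (toeplitz a m n). dist e x < \<delta> / 2) sequentially" if x: "x \<in> T" for x
  proof -
    obtain \<theta>0 where \<theta>0: "\<theta>0 \<in> {-pi..pi}" "x = f (curve \<theta>0)"
      using x T(1) unfolding curve_values_def by blast
    have real: "f (curve \<theta>) \<in> \<real>" if "\<theta> \<in> {-pi..pi}" for \<theta>
      using curve_values_real that unfolding curve_values_def by blast
    show ?thesis
      unfolding \<theta>0(2) using assms by (intro eigenvalues_near_curve_value[OF real near \<theta>0(1)] half_gt_zero)
  qed
  then have "eventually (\<lambda>n. \<forall>x\<in>T. \<exists>e\<in>spectrum (toeplitz a m n). dist e x < \<delta> / 2) sequentially"
    using T(2) by (intro eventually_ball_finite) auto
  then show ?thesis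
  proof eventually_elim
    case (elim n)
    show ?case
    proof
      fix y assume "y \<in> curve_values"
      then obtain x where x: "x \<in> T" "dist x y < \<delta> / 2" using T(3) by auto
      then obtain e where "e \<in> spectrum (toeplitz a m n)" "dist e x < \<delta> / 2" using elim by blast
      moreover have "dist e y \<le> dist e x + dist x y" by (rule dist_triangle)
      ultimately show "\<exists>e\<in>spectrum (toeplitz a m n). dist e y < \<delta>"
        using x(2) by (intro bexI[of _ e]) auto
    qed
  qed
qed

end

lemma hausdorff_limitI:
  fixes S :: "nat \<Rightarrow> 'a::metric_space set"
  assumes "L \<noteq> {}" "eventually (\<lambda>n. S n \<noteq> {}) sequentially"
    and "\<And>\<delta>. 0 < \<delta> \<Longrightarrow> eventually (\<lambda>n. \<forall>e\<in>S n. \<exists>x\<in>L. dist e x < \<delta>) sequentially"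
    and "\<And>\<delta>. 0 < \<delta> \<Longrightarrow> eventually (\<lambda>n. \<forall>x\<in>L. \<exists>e\<in>S n. dist e x < \<delta>) sequentially"
  shows "hausdorff_limit S L"
  unfolding hausdorff_limit_def
proof (rule tendstoI)
  fix \<epsilon> :: real assume "0 < \<epsilon>"
  then have \<epsilon>: "0 < \<epsilon> / 2" by simp
  have sup: "0 \<le> (SUP x\<in>A. infdist x B) \<and> (SUP x\<in>A. infdist x B) \<le> \<epsilon> / 2"
    if ne: "A \<noteq> {}" and near: "\<And>x. x \<in> A \<Longrightarrow> \<exists>y\<in>B. dist x y < \<epsilon> / 2" for A B :: "'a set"
  proof
    have le: "infdist x B \<le> \<epsilon> / 2" if "x \<in> A" for x
      using near[OF that] infdist_le2[of _ B x "\<epsilon> / 2"] by (auto simp: less_imp_le)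
    then show "(SUP x\<in>A. infdist x B) \<le> \<epsilon> / 2" using ne by (intro cSUP_least) auto
    obtain x where x: "x \<in> A" using ne by blast
    have "bdd_above ((\<lambda>x. infdist x B) ` A)" using le by (intro bdd_aboveI[of _ "\<epsilon> / 2"]) auto
    from cSUP_upper[OF x this] infdist_nonneg[of x B] show "0 \<le> (SUP x\<in>A. infdist x B)" by linarith
  qed
  show "eventually (\<lambda>n. dist (hausdorff_dist (S n) L) 0 < \<epsilon>) sequentially"
    using assms(2) assms(3)[OF \<epsilon>] assms(4)[OF \<epsilon>]
  proof eventually_elim
    case (elim n)
    have "0 \<le> (SUP x\<in>S n. infdist x L) \<and> (SUP x\<in>S n. infdist x L) \<le> \<epsilon> / 2"
      using elim by (intro sup) auto
    moreover have "0 \<le> (SUP y\<in>L. infdist y (S n)) \<and> (SUP y\<in>L. infdist y (S n)) \<le> \<epsilon> / 2"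
      using elim assms(1) by (intro sup) (auto simp: dist_commute)
    ultimately show ?case
      using \<open>0 < \<epsilon>\<close> by (auto simp: hausdorff_dist_def dist_real_def)
  qed
qed

theorem theorem2p11:
  fixes a :: "int \<Rightarrow> real" and m :: nat
    and z :: "nat \<Rightarrow> complex \<Rightarrow> complex"
    and r \<beta> :: "real \<Rightarrow> real"
  assumes "m \<ge> 1"
    and "a (int m) \<noteq> 0" and "a (- int m) \<noteq> 0"
    and "sorted_roots a m z"
    and "C1_polar_radius r"
    and "\<And>\<alpha>. \<alpha> \<in> {-pi..pi} \<Longrightarrow> r \<alpha> = exp (- \<beta> \<alpha>)"
    and "middle_roots m z = polar_curve r"
    and "separated m z"
  shows "hausdorff_limit (\<lambda>n. spectrum (toeplitz a m n))
           (\<Union>\<alpha>\<in>{-pi..pi}. {laurent a m (exp (\<i> * (of_real \<alpha> + \<i> * of_real (\<beta> \<alpha>))))})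
       \<and> (\<Union>\<alpha>\<in>{-pi..pi}. {laurent a m (exp (\<i> * (of_real \<alpha> + \<i> * of_real (\<beta> \<alpha>))))}) \<subseteq> \<real>"
proof -
  interpret curve_symbol a m z r
    using assms by unfold_locales auto
  have "exp (\<i> * (of_real \<alpha> + \<i> * of_real (\<beta> \<alpha>))) = curve \<alpha>" if "\<alpha> \<in> {-pi..pi}" for \<alpha>
  proof -
    have "\<i> * (of_real \<alpha> + \<i> * of_real (\<beta> \<alpha>)) = complex_of_real (- \<beta> \<alpha>) + \<i> * of_real \<alpha>"
      by (simp add: algebra_simps)
    then show ?thesis
      using assms(6)[OF that] by (simp add: exp_add curve_def cis_conv_exp exp_of_real del: of_real_minus)
  qed
  then have limit_set: "(\<Union>\<alpha>\<in>{-pi..pi}. {laurent a m (exp (\<i> * (of_real \<alpha> + \<i> * of_real (\<beta> \<alpha>))))}) = curve_values"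
    unfolding curve_values_def by auto
  have "hausdorff_limit (\<lambda>n. spectrum (toeplitz a m n)) curve_values"
  proof (rule hausdorff_limitI)
    show "curve_values \<noteq> {}" by (simp add: curve_values_def)
    show "eventually (\<lambda>n. spectrum (toeplitz a m n) \<noteq> {}) sequentially"
      using eventually_gt_at_top[of 0]
      by eventually_elim (rule spectrum_non_empty[OF toeplitz_carrier])
  qed (fact spectrum_near_curve_values curve_values_near_spectrum)+
  then show ?thesis unfolding limit_set using curve_values_real by blast
qed

end
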